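(* The system of rational functions $\{A_{\psi_1},\,B_{\psi_2}:\ \psi_1\in\Psi_1,\ \psi_2\in\Psi_2\}\subset K(\mathfrak m)$ is algebraically independent over $K$.
   Context: Setting. $K$ is an algebraically closed field of characteristic zero, $G=\mathrm{GL}(n,K)$, $B$ (resp. $N$) is the subgroup of upper triangular (resp. upper unitriangular) matrices. $P\supset B$ is a parabolic subgroup of block upper triangular matrices with diagonal blocks of sizes $(r_1,\dots,r_u)$, $r_1+\dots+r_u=n$; put $R_k=r_1+\dots+r_k$, $R_0=0$. The Lie algebra of $P$ is $\mathfrak p=\mathfrak r\oplus\mathfrak m$, with $\mathfrak r$ the block diagonal subalgebra and $\mathfrak m$ the nilradical (strictly block upper triangular matrices). Roots. A positive root $\varepsilon_i-\varepsilon_j$ ($1\le i<j\le n$) is identified with the pair $(i,j)$; $\Delta^+$ is the set of all positive roots. $\Delta^+_{\mathfrak r}$ is the set of $(i,j)$, $i<j$, with $i,j$ in the same diagonal block; $M=\Delta^+\setminus\Delta^+_{\mathfrak r}$ is the set of roots of $\mathfrak m$. $K[\mathfrak m]$ is the polynomial algebra in the coordinates $x_{i,j}$, $(i,j)\in M$, and $K(\mathfrak m)$ its fraction field. For roots write $\gamma'>\gamma$ if $\gamma'-\gamma\in\Delta^+$ (not an order relation); $\gamma,\gamma'$ are comparable if $\gamma'>\gamma$ or $\gamma>\gamma'$. "Root in row $i$ / column $j$" means a pair with first entry $i$ / second entry $j$. Base. The base $S$ is the unique subset $S\subset M$ whose elements are pairwise non-comparable and such that for each $\gamma\in M\setminus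 S$ there is $\xi\in S$ with $\gamma>\xi$. Each row and each column contains at most one root of $S$. Minors. $\mathbb X$ is the $n\times n$ matrix with entry $x_{i,j}$ at $(i,j)\in M$ and $0$ elsewhere. For $\gamma=(a,b)\in M$ let $S_\gamma=\{(i,j)\in S: i>a,\ j<b\}=\{(i_1,j_1),\dots,(i_k,j_k)\}$; $M_\gamma$ is the minor of $\mathbb X$ with (increasingly ordered) rows $\{a,i_1,\dots,i_k\}$ and columns $\{j_1,\dots,j_k,b\}$. The set $\Phi$ and polynomials $L_\varphi$. An admissible pair is $q=(\xi,\xi')$ with $\xi=(i,j)\in S$, $\xi'=(k,l)\in S$ and $\alpha_q:=(j,k)\in\Delta^+_{\mathfrak r}$. Put $\varphi_q=\alpha_q+\xi'=(j,l)$ and $\Phi=\{\varphi_q\}$ over all admissible pairs $q$ (the pair $q$ is determined by $\varphi_q$). For $\varphi=\varphi_q$, $L_\varphi=\sum M_{\xi+\alpha_1}M_{\alpha_2+\xi'}$, the sum being over $\alpha_1,\alpha_2\in\Delta^+_{\mathfrak r}\cup\{0\}$ with $\alpha_1+\alpha_2=\alpha_q$. First series. $\Psi_1$ is the set of $\psi=(i,b)\in\Phi$ for which there exist $j>i$ and $a<b$ such that $\xi_1=(i,a)$, $\xi_2=(j,a)$, $\xi_3=(j,b)$ all lie in $S\cup\Phi$; then automatically $\xi_1,\xi_2\in\Phi$. Let $(\gamma,\gamma')$ be the admissible pair corresponding to $\xi_2$. For each $\psi\in\Psi_1$ a choice of such $\xi_1,\xi_2,\xi_3$ is fixed, and $$A_\psi=\frac{L_\psi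 L_{\xi_2}}{L_{\xi_1}L_{\xi_3}}\ \text{ if }\xi_3\in\Phi,\qquad A_\psi=\frac{L_\psi L_{\xi_2}}{L_{\xi_1}M_\gamma M_{\xi_3}}\ \text{ if }\xi_3\in S.$$ Second series. $\Psi_2$ is the set of $\psi\in\Phi$ of the form $\psi=(R_{t-1}+k,R_t+1)$ with $1\le k<r_t$ for which there is $s<t$ such that row $R_{s-1}+1$ contains at least $k$ roots of $\Phi$. Take the maximal such $s$, let $(R_{s-1}+1,j_1),\dots,(R_{s-1}+1,j_k)$, $j_1<\dots<j_k$, be the first $k$ roots of $\Phi$ in that row (smallest columns), and put $\xi_1=(R_{s-1}+1,j_k)$. Put $\gamma_1=(R_{s-1},R_{s-1}+1)\in S$ and $\gamma_3=(R_t,R_t+1)\in S$, and let $\gamma_4$ be the root of $S$ in column $R_{t-1}+k+1$. Define $\gamma_5$ and $D$ by: - if $r_s=r_t$: $\gamma_5=(R_{s-1}+1,R_t)\in S$ and $D=M_{\gamma_1}M_{\gamma_3}M_{\gamma_5}$; - if $r_s<r_t$: $\gamma_5$ is the root of $S$ in row $R_{s-1}+1$, $\xi_2\in\Phi$ is the root corresponding to the admissible pair $(\gamma_5,\gamma_3)$, and $D=M_{\gamma_1}L_{\xi_2}$; - if $r_s>r_t$: $\gamma_5$ is the root of $S$ in column $R_t$, $\xi_3=(R_{s-1}+1,R_t)\in\Phi$ is the root corresponding to the admissible pair $(\gamma_1,\gamma_5)$, and $D=M_{\gamma_3}L_{\xi_3}$. For roots write $(a_1,b_1)\succ(a_2,b_2)$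 if $a_1<a_2$ and $b_1>b_2$. For a root $\gamma$ let $\mathrm{Max}(\gamma)$ be the set of $\prec$-maximal elements of $\{\mu\in S:\mu\prec\gamma\}$. If $t=s+1$ and ($r_s=2$ or $r_t=2$), then $B_\psi=\dfrac{L_\psi L_{\xi_1}}{D}$. Otherwise (that is, $r_s,r_t>2$, or $t\ne s+1$ and $r_s,r_t\ge2$), $$B_\psi=\frac{L_{\xi_1}L_\psi\prod_{\mu\in\mathrm{Max}(\gamma_5)}M_\mu}{D\cdot\prod_{\mu\in\mathrm{Max}(\gamma_4)}M_\mu\cdot\prod_{\mu'}M_{\mu'}},$$ where the last product is over all $\mu'\in S$ belonging to $\mathrm{Max}(\mu)$ for some $\mu\in\mathrm{Max}(\gamma_4)$. *)

theory Defs
  imports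
    "HOL-Library.Poly_Mapping"
    "HOL-Library.Product_Lexorder"
    "HOL-Computational_Algebra.Polynomial_Factorial"
    "Jordan_Normal_Form.Determinant"
    "Jordan_Normal_Form.DL_Submatrix"
begin

section \<open>Roots of a standard parabolic subalgebra of gl(n)\<close>

text \<open>
  The parabolic subgroup \<open>P\<close> of block upper triangular matrices enters only through the list
  \<open>rs = [r\<^sub>1, \<dots>, r\<^sub>u]\<close> of positive block sizes; \<open>n = sum_list rs\<close>.  All
  row, column and block indices start at 1.
\<close>

type_synonym root = "nat \<times> nat"

definition bsize :: "nat list \<Rightarrow> nat \<Rightarrow> nat" where
  "bsize rs t = rs ! (t - 1)"

definition bsum :: "nat list \<Rightarrow> nat \<Rightarrow> nat" where
  "bsum rs k = sum_list (take k rs)"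

definition pos_roots :: "nat list \<Rightarrow> root set" where
  "pos_roots rs = {(i, j). 1 \<le> i \<and> i < j \<and> j \<le> sum_list rs}"

definition in_block :: "nat list \<Rightarrow> nat \<Rightarrow> nat \<Rightarrow> bool" where
  "in_block rs t i \<longleftrightarrow> t \<in> {1..length rs} \<and> bsum rs (t - 1) < i \<and> i \<le> bsum rs t"

definition roots_r :: "nat list \<Rightarrow> root set" where
  "roots_r rs = {(i, j) \<in> pos_roots rs. \<exists>t. in_block rs t i \<and> in_block rs t j}"

definition roots_m :: "nat list \<Rightarrow> root set" where
  "roots_m rs = pos_roots rs - roots_r rs"

text \<open>The pair \<open>(i, j)\<close> stands for \<open>\<epsilon>\<^sub>i - \<epsilon>\<^sub>j\<close>, here an element of the free abelian
  group on the \<open>\<epsilon>\<^sub>i\<close>, in which sums and differences of roots are formed.\<close>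

definition weight :: "root \<Rightarrow> nat \<Rightarrow>\<^sub>0 int" where
  "weight \<gamma> = Poly_Mapping.single (fst \<gamma>) 1 - Poly_Mapping.single (snd \<gamma>) 1"

definition root_of :: "nat list \<Rightarrow> (nat \<Rightarrow>\<^sub>0 int) \<Rightarrow> root" where
  "root_of rs w = (THE \<gamma>. \<gamma> \<in> pos_roots rs \<and> weight \<gamma> = w)"

definition root_gt :: "nat list \<Rightarrow> root \<Rightarrow> root \<Rightarrow> bool" where
  "root_gt rs \<gamma>' \<gamma> \<longleftrightarrow> weight \<gamma>' - weight \<gamma> \<in> weight ` pos_roots rs"

definition root_comparable :: "nat list \<Rightarrow> root \<Rightarrow> root \<Rightarrow> bool" where
  "root_comparable rs \<gamma> \<gamma>' \<longleftrightarrow> root_gt rs \<gamma>' \<gamma> \<or> root_gt rs \<gamma> \<gamma>'"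

definition root_succ :: "root \<Rightarrow> root \<Rightarrow> bool" where
  "root_succ \<gamma> \<mu> \<longleftrightarrow> fst \<gamma> < fst \<mu> \<and> snd \<gamma> > snd \<mu>"

section \<open>The base\<close>

definition is_base :: "nat list \<Rightarrow> root set \<Rightarrow> bool" where
  "is_base rs S \<longleftrightarrow> S \<subseteq> roots_m rs
     \<and> (\<forall>\<gamma>\<in>S. \<forall>\<gamma>'\<in>S. \<gamma> \<noteq> \<gamma>' \<longrightarrow> \<not> root_comparable rs \<gamma> \<gamma>')
     \<and> (\<forall>\<gamma>\<in>roots_m rs - S. \<exists>\<xi>\<in>S. root_gt rs \<gamma> \<xi>)"

definition base :: "nat list \<Rightarrow> root set" where
  "base rs = (THE S. is_base rs S)"

section \<open>The rational function field and the minors\<close>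

text \<open>
  Polynomials have variables \<open>x\<^sub>i\<^sub>j\<close> for all pairs of naturals; \<open>K[m]\<close> and \<open>K(m)\<close> are
  the subring and subfield belonging to the variables indexed by \<open>roots_m rs\<close>.  The lexicographic
  order on pairs is used only because the integral domain instance of \<open>poly_mapping\<close> requires
  linearly ordered variables.
\<close>

type_synonym ('i, 'a) mpoly = "('i \<Rightarrow>\<^sub>0 nat) \<Rightarrow>\<^sub>0 'a"
type_synonym 'a ratfun = "(nat \<times> nat, 'a) mpoly fract"

definition mp_var :: "'i \<Rightarrow> ('i, 'a::comm_ring_1) mpoly" where
  "mp_var i = Poly_Mapping.single (Poly_Mapping.single i 1) 1"

definition mp_const :: "'a \<Rightarrow> ('i, 'a::comm_ring_1) mpoly" where
  "mp_const c = Poly_Mapping.single 0 c"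

definition mp_over :: "'i set \<Rightarrow> ('i, 'a::comm_ring_1) mpoly set" where
  "mp_over I = {p. \<forall>m\<in>Poly_Mapping.keys p. Poly_Mapping.keys m \<subseteq> I}"

definition ratfun_m :: "nat list \<Rightarrow> 'a::field ratfun set" where
  "ratfun_m rs = {to_fract p / to_fract q |p q.
     p \<in> mp_over (roots_m rs) \<and> q \<in> mp_over (roots_m rs) \<and> q \<noteq> 0}"

text \<open>Matrix entries are indexed from 0, hence the shifts.\<close>

definition gen_mat :: "nat list \<Rightarrow> (nat \<times> nat, 'a::comm_ring_1) mpoly mat" where
  "gen_mat rs = mat (sum_list rs) (sum_list rs)
     (\<lambda>(i, j). if (i + 1, j + 1) \<in> roots_m rs then mp_var (i + 1, j + 1) else 0)"

definition base_inside :: "nat list \<Rightarrow> root \<Rightarrow> root set" where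
  "base_inside rs \<gamma> = {(i, j) \<in> base rs. i > fst \<gamma> \<and> j < snd \<gamma>}"

definition minorM :: "nat list \<Rightarrow> root \<Rightarrow> (nat \<times> nat, 'a::comm_ring_1) mpoly" where
  "minorM rs \<gamma> = det (submatrix (gen_mat rs)
     ((\<lambda>i. i - 1) ` insert (fst \<gamma>) (fst ` base_inside rs \<gamma>))
     ((\<lambda>j. j - 1) ` insert (snd \<gamma>) (snd ` base_inside rs \<gamma>)))"

section \<open>Admissible pairs and the polynomials L\<close>

definition alpha_of :: "root \<times> root \<Rightarrow> root" where
  "alpha_of q = (snd (fst q), fst (snd q))"

definition phi_of :: "root \<times> root \<Rightarrow> root" where
  "phi_of q = (snd (fst q), snd (snd q))"

definition admissible :: "nat list \<Rightarrow> root \<times> root \<Rightarrow> bool" where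
  "admissible rs q \<longleftrightarrow> fst q \<in> base rs \<and> snd q \<in> base rs \<and> alpha_of q \<in> roots_r rs"

definition Phi :: "nat list \<Rightarrow> root set" where
  "Phi rs = phi_of ` {q. admissible rs q}"

definition pair_of :: "nat list \<Rightarrow> root \<Rightarrow> root \<times> root" where
  "pair_of rs \<phi> = (THE q. admissible rs q \<and> phi_of q = \<phi>)"

text \<open>
  \<open>\<alpha>\<^sub>1 + \<alpha>\<^sub>2 = \<alpha>\<^sub>q\<close> also has the solutions with the two summands interchanged; for those
  \<open>\<xi> + \<alpha>\<^sub>1\<close> is not a root and there is no such minor.  The sum is over the
  decompositions for which both minors are defined; see \<open>polyL_eq\<close> below for the explicit form.
\<close>

definition decomps :: "nat list \<Rightarrow> root \<times> root \<Rightarrow> ((nat \<Rightarrow>\<^sub>0 int) \<times> (nat \<Rightarrow>\<^sub>0 int)) set" where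
  "decomps rs q = {(\<alpha>\<^sub>1, \<alpha>\<^sub>2).
     \<alpha>\<^sub>1 \<in> insert 0 (weight ` roots_r rs) \<and> \<alpha>\<^sub>2 \<in> insert 0 (weight ` roots_r rs)
     \<and> \<alpha>\<^sub>1 + \<alpha>\<^sub>2 = weight (alpha_of q)
     \<and> weight (fst q) + \<alpha>\<^sub>1 \<in> weight ` roots_m rs \<and> \<alpha>\<^sub>2 + weight (snd q) \<in> weight ` roots_m rs}"

definition polyL :: "nat list \<Rightarrow> root \<Rightarrow> (nat \<times> nat, 'a::comm_ring_1) mpoly" where
  "polyL rs \<phi> = (let q = pair_of rs \<phi> in
     \<Sum>(\<alpha>\<^sub>1, \<alpha>\<^sub>2)\<in>decomps rs q.
       minorM rs (root_of rs (weight (fst q) + \<alpha>\<^sub>1)) * minorM rs (root_of rs (\<alpha>\<^sub>2 + weight (snd q))))"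

abbreviation fM :: "nat list \<Rightarrow> root \<Rightarrow> 'a::idom ratfun" where
  "fM rs \<gamma> \<equiv> to_fract (minorM rs \<gamma>)"

abbreviation fL :: "nat list \<Rightarrow> root \<Rightarrow> 'a::idom ratfun" where
  "fL rs \<phi> \<equiv> to_fract (polyL rs \<phi>)"

section \<open>The first series\<close>

definition is_rectangle :: "nat list \<Rightarrow> root \<Rightarrow> root \<times> root \<times> root \<Rightarrow> bool" where
  "is_rectangle rs \<psi> w \<longleftrightarrow> (\<exists>i j a b. \<psi> = (i, b) \<and> j > i \<and> a < b
     \<and> w = ((i, a), (j, a), (j, b)) \<and> {(i, a), (j, a), (j, b)} \<subseteq> base rs \<union> Phi rs)"

definition Psi1 :: "nat list \<Rightarrow> root set" where
  "Psi1 rs = {\<psi> \<in> Phi rs. \<exists>w. is_rectangle rs \<psi> w}"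

text \<open>The base and \<open>Phi\<close> are disjoint (\<open>base_Phi_disjoint\<close> below), so the second branch is
  the case \<open>\<xi>\<^sub>3 \<in> base rs\<close>.\<close>

definition A_fun :: "nat list \<Rightarrow> root \<times> root \<times> root \<Rightarrow> root \<Rightarrow> 'a::field ratfun" where
  "A_fun rs w \<psi> = (case w of (\<xi>\<^sub>1, \<xi>\<^sub>2, \<xi>\<^sub>3) \<Rightarrow>
     if \<xi>\<^sub>3 \<in> Phi rs then fL rs \<psi> * fL rs \<xi>\<^sub>2 / (fL rs \<xi>\<^sub>1 * fL rs \<xi>\<^sub>3)
     else fL rs \<psi> * fL rs \<xi>\<^sub>2 / (fL rs \<xi>\<^sub>1 * fM rs (fst (pair_of rs \<xi>\<^sub>2)) * fM rs \<xi>\<^sub>3))"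

section \<open>The second series\<close>

definition Phi_cols :: "nat list \<Rightarrow> nat \<Rightarrow> nat set" where
  "Phi_cols rs i = {j. (i, j) \<in> Phi rs}"

definition psi2_form :: "nat list \<Rightarrow> root \<Rightarrow> nat \<times> nat \<Rightarrow> bool" where
  "psi2_form rs \<psi> p \<longleftrightarrow> (case p of (t, k) \<Rightarrow> t \<in> {1..length rs} \<and> 1 \<le> k \<and> k < bsize rs t
     \<and> \<psi> = (bsum rs (t - 1) + k, bsum rs t + 1))"

definition s_candidates :: "nat list \<Rightarrow> nat \<times> nat \<Rightarrow> nat set" where
  "s_candidates rs p = (case p of (t, k) \<Rightarrow>
     {s. 1 \<le> s \<and> s < t \<and> card (Phi_cols rs (bsum rs (s - 1) + 1)) \<ge> k})"

definition Psi2 :: "nat list \<Rightarrow> root set" where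
  "Psi2 rs = {\<psi> \<in> Phi rs. \<exists>p. psi2_form rs \<psi> p \<and> s_candidates rs p \<noteq> {}}"

definition base_in_row :: "nat list \<Rightarrow> nat \<Rightarrow> root" where
  "base_in_row rs i = (THE \<gamma>. \<gamma> \<in> base rs \<and> fst \<gamma> = i)"

definition base_in_col :: "nat list \<Rightarrow> nat \<Rightarrow> root" where
  "base_in_col rs j = (THE \<gamma>. \<gamma> \<in> base rs \<and> snd \<gamma> = j)"

definition MaxS :: "nat list \<Rightarrow> root \<Rightarrow> root set" where
  "MaxS rs \<gamma> = {\<mu> \<in> base rs. root_succ \<gamma> \<mu>
     \<and> \<not> (\<exists>\<nu>\<in>base rs. root_succ \<gamma> \<nu> \<and> root_succ \<nu> \<mu>)}"

definition gamma5 :: "nat list \<Rightarrow> nat \<Rightarrow> nat \<Rightarrow> root" where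
  "gamma5 rs s t =
     (if bsize rs s = bsize rs t then (bsum rs (s - 1) + 1, bsum rs t)
      else if bsize rs s < bsize rs t then base_in_row rs (bsum rs (s - 1) + 1)
      else base_in_col rs (bsum rs t))"

definition D_fun :: "nat list \<Rightarrow> nat \<Rightarrow> nat \<Rightarrow> 'a::field ratfun" where
  "D_fun rs s t = (let
       \<gamma>\<^sub>1 = (bsum rs (s - 1), bsum rs (s - 1) + 1);
       \<gamma>\<^sub>3 = (bsum rs t, bsum rs t + 1);
       \<gamma>\<^sub>5 = gamma5 rs s t
     in if bsize rs s = bsize rs t then fM rs \<gamma>\<^sub>1 * fM rs \<gamma>\<^sub>3 * fM rs \<gamma>\<^sub>5
        else if bsize rs s < bsize rs t then fM rs \<gamma>\<^sub>1 * fL rs (phi_of (\<gamma>\<^sub>5, \<gamma>\<^sub>3))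
        else fM rs \<gamma>\<^sub>3 * fL rs (phi_of (\<gamma>\<^sub>1, \<gamma>\<^sub>5)))"

definition B_fun :: "nat list \<Rightarrow> root \<Rightarrow> 'a::field ratfun" where
  "B_fun rs \<psi> = (let
       p = (THE p. psi2_form rs \<psi> p);
       t = fst p;
       k = snd p;
       s = Max (s_candidates rs p);
       i = bsum rs (s - 1) + 1;
       \<xi>\<^sub>1 = (i, sorted_list_of_set (Phi_cols rs i) ! (k - 1));
       \<gamma>\<^sub>4 = base_in_col rs (bsum rs (t - 1) + k + 1);
       \<gamma>\<^sub>5 = gamma5 rs s t
     in if t = s + 1 \<and> (bsize rs s = 2 \<or> bsize rs t = 2)
        then fL rs \<psi> * fL rs \<xi>\<^sub>1 / D_fun rs s t
        else fL rs \<xi>\<^sub>1 * fL rs \<psi> * (\<Prod>\<mu>\<in>MaxS rs \<gamma>\<^sub>5. fM rs \<mu>)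
          / (D_fun rs s t * (\<Prod>\<mu>\<in>MaxS rs \<gamma>\<^sub>4. fM rs \<mu>)
             * (\<Prod>\<mu>'\<in>(\<Union>\<mu>\<in>MaxS rs \<gamma>\<^sub>4. MaxS rs \<mu>). fM rs \<mu>')))"

section \<open>Algebraic independence of families\<close>

definition mp_eval :: "('a::comm_ring_1 \<Rightarrow> 'b::comm_ring_1) \<Rightarrow> ('i \<Rightarrow> 'b) \<Rightarrow> ('i, 'a) mpoly \<Rightarrow> 'b" where
  "mp_eval e f p = (\<Sum>m\<in>Poly_Mapping.keys p. e (Poly_Mapping.lookup p m)
     * (\<Prod>i\<in>Poly_Mapping.keys m. f i ^ Poly_Mapping.lookup m i))"

text \<open>Independence is that of an indexed family, so its members are distinct and nonzero; in particular
  the convention \<open>x / 0 = 0\<close> cannot make an independent quotient out of a vanishing denominator.\<close>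

definition alg_independent :: "'i set \<Rightarrow> ('i \<Rightarrow> 'a::field ratfun) \<Rightarrow> bool" where
  "alg_independent I f \<longleftrightarrow>
     (\<forall>p :: ('i, 'a) mpoly. p \<in> mp_over I \<longrightarrow> mp_eval (\<lambda>c. to_fract (mp_const c)) f p = 0 \<longrightarrow> p = 0)"

section \<open>The definite descriptions are well-defined; explicit forms of the root-sum conditions\<close>

lemma lookup_weight:
  "Poly_Mapping.lookup (weight (a, b)) x = of_bool (x = a) - of_bool (x = b)"
  by (auto simp: weight_def lookup_minus lookup_single when_def)

lemma root_gt_iff:
  assumes "(a, b) \<in> pos_roots rs" "(c, d) \<in> pos_roots rs"
  shows "root_gt rs (a, b) (c, d) \<longleftrightarrow> (a = c \<and> d < b) \<or> (b = d \<and> a < c)"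
proof
  assume "root_gt rs (a, b) (c, d)"
  then obtain x y where xy: "(x, y) \<in> pos_roots rs" "weight (a, b) - weight (c, d) = weight (x, y)"
    unfolding root_gt_def by (metis imageE surj_pair)
  have *: "of_bool (z = a) - of_bool (z = b) - (of_bool (z = c) - of_bool (z = d))
      = (of_bool (z = x) - of_bool (z = y) :: int)" for z
    using arg_cong[OF xy(2), of "\<lambda>w. Poly_Mapping.lookup w z"] by (simp add: lookup_minus lookup_weight)
  have "a < b" "c < d" "x < y" using assms xy(1) by (auto simp: pos_roots_def)
  consider "a = c" | "a \<noteq> c" "b = d" | "a \<noteq> c" "b \<noteq> d" by blast
  then show "(a = c \<and> d < b) \<or> (b = d \<and> a < c)"
  proof cases
    case 1
    then have "b \<noteq> d" using *[of x] \<open>x < y\<close> by auto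
    then have "d = x" "b = y" using *[of d] *[of b] 1 by (auto simp: of_bool_def split: if_splits)
    then show ?thesis using 1 \<open>x < y\<close> by simp
  next
    case 2
    then have "a = x" "c = y" using *[of a] *[of c] by (auto simp: of_bool_def split: if_splits)
    then show ?thesis using 2 \<open>x < y\<close> by simp
  next
    case 3
    then have "a = x" "a \<noteq> d" using *[of a] \<open>a < b\<close> by (auto simp: of_bool_def split: if_splits)
    moreover have "d = x" using *[of d] 3 \<open>c < d\<close> by (auto simp: of_bool_def split: if_splits)
    ultimately show ?thesis by simp
  qed
next
  assume "(a = c \<and> d < b) \<or> (b = d \<and> a < c)"
  then have "weight (a, b) - weight (c, d) = (if a = c then weight (d, b) else weight (a, c))"
    "(if a = c then (d, b) else (a, c)) \<in> pos_roots rs"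
    using assms by (auto simp: weight_def pos_roots_def)
  then show "root_gt rs (a, b) (c, d)" unfolding root_gt_def by (metis imageI)
qed

lemma roots_m_pos: "\<gamma> \<in> roots_m rs \<Longrightarrow> \<gamma> \<in> pos_roots rs"
  and roots_r_pos: "\<gamma> \<in> roots_r rs \<Longrightarrow> \<gamma> \<in> pos_roots rs"
  by (auto simp: roots_m_def roots_r_def)

lemma root_gt_height:
  assumes "root_gt rs \<gamma>' \<gamma>" "\<gamma>' \<in> roots_m rs" "\<gamma> \<in> roots_m rs"
  shows "snd \<gamma> - fst \<gamma> < snd \<gamma>' - fst \<gamma>'"
proof -
  obtain a b c d where [simp]: "\<gamma>' = (a, b)" "\<gamma> = (c, d)" by fastforce
  show ?thesis using assms root_gt_iff[of a b rs c d] roots_m_pos[of \<gamma> rs] roots_m_pos[of \<gamma>' rs]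
    by (auto simp: pos_roots_def)
qed

lemma is_base_iff:
  "is_base rs S \<longleftrightarrow> (\<forall>\<gamma>. \<gamma> \<in> S \<longleftrightarrow> \<gamma> \<in> roots_m rs \<and> \<not> (\<exists>\<xi>\<in>S. root_gt rs \<gamma> \<xi>))"
proof -
  have irr: "\<not> root_gt rs \<gamma> \<gamma>" if "\<gamma> \<in> roots_m rs" for \<gamma>
    using root_gt_height[OF _ that that] by blast
  show ?thesis
  proof
    assume S: "is_base rs S"
    show "\<forall>\<gamma>. \<gamma> \<in> S \<longleftrightarrow> \<gamma> \<in> roots_m rs \<and> \<not> (\<exists>\<xi>\<in>S. root_gt rs \<gamma> \<xi>)"
    proof (intro allI iffI conjI notI)
      fix \<gamma> assume "\<gamma> \<in> S"
      then show m: "\<gamma> \<in> roots_m rs" using S by (auto simp: is_base_def)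
      assume "\<exists>\<xi>\<in>S. root_gt rs \<gamma> \<xi>"
      then obtain \<xi> where "\<xi> \<in> S" "root_gt rs \<gamma> \<xi>" by blast
      then show False
        using S \<open>\<gamma> \<in> S\<close> irr[OF m] by (cases "\<gamma> = \<xi>") (auto simp: is_base_def root_comparable_def)
    next
      fix \<gamma> assume "\<gamma> \<in> roots_m rs \<and> \<not> (\<exists>\<xi>\<in>S. root_gt rs \<gamma> \<xi>)"
      then show "\<gamma> \<in> S" using S by (auto simp: is_base_def)
    qed
  next
    assume "\<forall>\<gamma>. \<gamma> \<in> S \<longleftrightarrow> \<gamma> \<in> roots_m rs \<and> \<not> (\<exists>\<xi>\<in>S. root_gt rs \<gamma> \<xi>)"
    then have S: "\<gamma> \<in> S \<longleftrightarrow> \<gamma> \<in> roots_m rs \<and> \<not> (\<exists>\<xi>\<in>S. root_gt rs \<gamma> \<xi>)" for \<gamma> by (rule spec)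
    show "is_base rs S"
      unfolding is_base_def root_comparable_def
    proof (intro conjI ballI impI subsetI)
      show "\<gamma> \<in> roots_m rs" if "\<gamma> \<in> S" for \<gamma> using that S[of \<gamma>] by simp
      show "\<not> (root_gt rs \<gamma>' \<gamma> \<or> root_gt rs \<gamma> \<gamma>')" if "\<gamma> \<in> S" "\<gamma>' \<in> S" for \<gamma> \<gamma>'
        using that S[of \<gamma>] S[of \<gamma>'] by blast
      show "\<exists>\<xi>\<in>S. root_gt rs \<gamma> \<xi>" if "\<gamma> \<in> roots_m rs - S" for \<gamma>
        using that S[of \<gamma>] by blast
    qed
  qed
qed

lemma ex1_is_base: "\<exists>!S. is_base rs S"
proof -
  define h where "h \<gamma> = snd \<gamma> - fst \<gamma>" for \<gamma> :: root
  define F where "F = (\<lambda>(X :: root \<Rightarrow> bool) \<gamma>. \<gamma> \<in> roots_m rs \<and>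
    \<not> (\<exists>\<xi>\<in>roots_m rs. h \<xi> < h \<gamma> \<and> X \<xi> \<and> root_gt rs \<gamma> \<xi>))"
  define S where "S = {\<gamma>. wfrec (measure h) F \<gamma>}"
  have S: "\<gamma> \<in> S \<longleftrightarrow> \<gamma> \<in> roots_m rs \<and> \<not> (\<exists>\<xi>\<in>roots_m rs. h \<xi> < h \<gamma> \<and> \<xi> \<in> S \<and> root_gt rs \<gamma> \<xi>)" for \<gamma>
    unfolding S_def mem_Collect_eq by (subst wfrec) (auto simp: F_def cut_def)
  have ex: "is_base rs S"
    unfolding is_base_iff
  proof
    fix \<gamma>
    have "\<xi> \<in> roots_m rs" if "\<xi> \<in> S" for \<xi> using that S[of \<xi>] by simp
    then show "\<gamma> \<in> S \<longleftrightarrow> \<gamma> \<in> roots_m rs \<and> \<not> (\<exists>\<xi>\<in>S. root_gt rs \<gamma> \<xi>)"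
      using S[of \<gamma>] root_gt_height[of rs \<gamma>] unfolding h_def by metis
  qed
  have "S' = S" if S': "is_base rs S'" for S'
  proof -
    have "\<gamma> \<in> S' \<longleftrightarrow> \<gamma> \<in> S" for \<gamma>
    proof (induction "h \<gamma>" arbitrary: \<gamma> rule: less_induct)
      case less
      have 1: "\<gamma> \<in> T \<longleftrightarrow> \<gamma> \<in> roots_m rs \<and> \<not> (\<exists>\<xi>\<in>T. h \<xi> < h \<gamma> \<and> root_gt rs \<gamma> \<xi>)"
        if T: "is_base rs T" for T
      proof -
        have "T \<subseteq> roots_m rs" using T by (simp add: is_base_def)
        then show ?thesis
          using T[unfolded is_base_iff, rule_format, of \<gamma>] root_gt_height[of rs \<gamma>]
          unfolding h_def by (metis subsetD)
      qed
      show ?case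
        unfolding 1[OF S'] 1[OF ex] using less by blast
    qed
    then show ?thesis by blast
  qed
  with ex show ?thesis by blast
qed

lemma is_base_base: "is_base rs (base rs)"
  unfolding base_def by (rule theI'[OF ex1_is_base])

lemma base_row_col_inj:
  assumes "(a, b) \<in> base rs" "(c, d) \<in> base rs" "a = c \<or> b = d"
  shows "a = c \<and> b = d"
proof (rule ccontr)
  assume ne: "\<not> (a = c \<and> b = d)"
  have "(a, b) \<in> roots_m rs" "(c, d) \<in> roots_m rs" "\<not> root_comparable rs (a, b) (c, d)"
    using is_base_base[of rs] assms ne unfolding is_base_def by blast+
  then show False using ne assms(3) root_gt_iff[of a b rs c d] root_gt_iff[of c d rs a b]
    by (auto simp: root_comparable_def roots_m_pos)
qed

lemma base_Phi_disjoint: "base rs \<inter> Phi rs = {}"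
proof -
  have False if "(j, l) \<in> base rs" "(k, l) \<in> base rs" "(j, k) \<in> roots_r rs" for j k l
    using base_row_col_inj[OF that(1,2)] that(3) by (auto simp: roots_r_def pos_roots_def)
  then show ?thesis by (fastforce simp: Phi_def admissible_def phi_of_def alpha_of_def)
qed

lemma pair_of_phi:
  assumes "admissible rs q"
  shows "pair_of rs (phi_of q) = q"
  unfolding pair_of_def
proof (rule the_equality)
  fix q' assume q': "admissible rs q' \<and> phi_of q' = phi_of q"
  obtain i j k l where q: "q = ((i, j), (k, l))" by (metis prod.collapse)
  obtain i' j' k' l' where q'_eq: "q' = ((i', j'), (k', l'))" by (metis prod.collapse)
  have "j' = j" "l' = l" "(i, j) \<in> base rs" "(i', j) \<in> base rs" "(k, l) \<in> base rs" "(k', l) \<in> base rs"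
    using assms q' by (auto simp: q q'_eq admissible_def phi_of_def)
  then show "q' = q"
    using base_row_col_inj[of i j rs i' j] base_row_col_inj[of k l rs k' l] by (simp add: q q'_eq)
qed (use assms in simp)

lemma weight_inj:
  assumes "weight (a, b) = weight (c, d)" "a < b"
  shows "a = c \<and> b = d"
proof -
  have "of_bool (z = a) - of_bool (z = b) = (of_bool (z = c) - of_bool (z = d) :: int)" for z
    using arg_cong[OF assms(1), of "\<lambda>w. Poly_Mapping.lookup w z"] by (simp add: lookup_weight)
  from this[of a] this[of b] show ?thesis using assms(2) by (auto simp: of_bool_def split: if_splits)
qed

lemma root_of_weight: "\<gamma> \<in> pos_roots rs \<Longrightarrow> root_of rs (weight \<gamma>) = \<gamma>"
  unfolding root_of_def
  by (rule the_equality) (auto simp: pos_roots_def dest: weight_inj)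

lemma weight_add: "weight (a, b) + weight (b, c) = weight (a, c)"
  by (simp add: weight_def)

lemma weight_same [simp]: "weight (a, a) = 0"
  by (simp add: weight_def)

lemma bsum_mono: "i \<le> j \<Longrightarrow> bsum rs i \<le> bsum rs j"
  by (metis bsum_def le_add1 le_add_diff_inverse sum_list.append take_add)

lemma in_block_inj: "in_block rs s i \<Longrightarrow> in_block rs t i \<Longrightarrow> s = t"
proof (induction s t rule: linorder_wlog)
  case (le s t)
  show ?case
  proof (rule ccontr)
    assume "s \<noteq> t"
    then have "bsum rs s \<le> bsum rs (t - 1)" using le by (intro bsum_mono) simp
    then show False using le by (simp add: in_block_def)
  qed
qed auto

lemma
  assumes "(j, k) \<in> roots_r rs" "j \<le> m" "m \<le> k"
  shows roots_r_left: "j = m \<or> (j, m) \<in> roots_r rs" 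
    and roots_r_right: "m = k \<or> (m, k) \<in> roots_r rs"
    and roots_r_m_left: "(i, j) \<in> roots_m rs \<Longrightarrow> (i, m) \<in> roots_m rs"
    and roots_r_m_right: "(k, l) \<in> roots_m rs \<Longrightarrow> (m, l) \<in> roots_m rs"
proof -
  obtain t where t: "in_block rs t j" "in_block rs t k" using assms(1) by (auto simp: roots_r_def)
  have m: "in_block rs t m" using t assms by (auto simp: in_block_def)
  have b: "1 \<le> j" "k \<le> sum_list rs" using assms(1) by (auto simp: roots_r_def pos_roots_def)
  show "j = m \<or> (j, m) \<in> roots_r rs" "m = k \<or> (m, k) \<in> roots_r rs"
    using m t b assms by (auto simp: roots_r_def pos_roots_def)
  show "(i, m) \<in> roots_m rs" if "(i, j) \<in> roots_m rs"
  proof -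
    have ij: "(i, j) \<in> pos_roots rs" "\<not> in_block rs t i"
      using that t(1) by (auto simp: roots_m_def roots_r_def)
    have "(i, m) \<notin> roots_r rs"
    proof
      assume "(i, m) \<in> roots_r rs"
      then obtain t' where t': "in_block rs t' i" "in_block rs t' m" by (auto simp: roots_r_def)
      with in_block_inj[OF m t'(2)] ij(2) show False by simp
    qed
    moreover have "(i, m) \<in> pos_roots rs" using ij(1) b assms(2,3) by (simp add: pos_roots_def)
    ultimately show ?thesis by (simp add: roots_m_def)
  qed
  show "(m, l) \<in> roots_m rs" if "(k, l) \<in> roots_m rs"
  proof -
    have kl: "(k, l) \<in> pos_roots rs" "\<not> in_block rs t l"
      using that t(2) by (auto simp: roots_m_def roots_r_def)
    have "(m, l) \<notin> roots_r rs"
    proof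
      assume "(m, l) \<in> roots_r rs"
      then obtain t' where t': "in_block rs t' m" "in_block rs t' l" by (auto simp: roots_r_def)
      with in_block_inj[OF m t'(1)] kl(2) show False by simp
    qed
    moreover have "(m, l) \<in> pos_roots rs" using kl(1) b assms(2,3) by (simp add: pos_roots_def)
    ultimately show ?thesis by (simp add: roots_m_def)
  qed
qed

lemma decomps_eq:
  assumes "admissible rs ((i, j), (k, l))"
  shows "decomps rs ((i, j), (k, l)) = (\<lambda>m. (weight (j, m), weight (m, k))) ` {j..k}"
proof -
  have jk: "(j, k) \<in> roots_r rs" and S: "(i, j) \<in> base rs" "(k, l) \<in> base rs"
    using assms by (auto simp: admissible_def alpha_of_def)
  have M: "(i, j) \<in> roots_m rs" "(k, l) \<in> roots_m rs"
    using S is_base_base[of rs] by (auto simp: is_base_def)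
  have lt: "i < j" "j < k" "k < l"
    using M jk by (auto simp: roots_m_def roots_r_def pos_roots_def)
  show ?thesis
  proof (intro equalityI subsetI)
    fix p assume "p \<in> (\<lambda>m. (weight (j, m), weight (m, k))) ` {j..k}"
    then obtain m where m: "p = (weight (j, m), weight (m, k))" "j \<le> m" "m \<le> k" by auto
    have 1: "weight (j, m) \<in> insert 0 (weight ` roots_r rs)"
      "weight (m, k) \<in> insert 0 (weight ` roots_r rs)"
      using roots_r_left[OF jk m(2,3)] roots_r_right[OF jk m(2,3)] by auto
    have 2: "weight (i, j) + weight (j, m) \<in> weight ` roots_m rs"
      "weight (m, k) + weight (k, l) \<in> weight ` roots_m rs"
      using roots_r_m_left[OF jk m(2,3) M(1)] roots_r_m_right[OF jk m(2,3) M(2)]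
      by (auto simp: weight_add)
    show "p \<in> decomps rs ((i, j), (k, l))"
      unfolding decomps_def m(1) using 1 2 by (simp add: alpha_of_def weight_add)
  next
    fix p assume "p \<in> decomps rs ((i, j), (k, l))"
    then obtain a b where p: "p = (a, b)" "a \<in> insert 0 (weight ` roots_r rs)"
      "b \<in> insert 0 (weight ` roots_r rs)" "a + b = weight (j, k)"
      "weight (i, j) + a \<in> weight ` roots_m rs"
      by (auto simp: decomps_def alpha_of_def)
    consider "a = 0" | "b = 0" | x y z v where "a = weight (x, y)" "b = weight (z, v)"
      "(x, y) \<in> roots_r rs" "(z, v) \<in> roots_r rs"
      using p(2,3) by fastforce
    then show "p \<in> (\<lambda>m. (weight (j, m), weight (m, k))) ` {j..k}"
    proof cases
      case 1 then show ?thesis using p lt by (auto intro!: image_eqI[of _ _ j])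
    next
      case 2 then show ?thesis using p lt by (auto intro!: image_eqI[of _ _ k])
    next
      case 3
      have xy: "x < y" "z < v" using 3 by (auto simp: roots_r_def pos_roots_def)
      obtain c d where cd: "weight (i, j) + weight (x, y) = weight (c, d)" "c < d"
        using p(5) 3(1) by (auto simp: roots_m_def pos_roots_def)
      have e1: "of_bool (w = x) - of_bool (w = y) + (of_bool (w = z) - of_bool (w = v))
          = (of_bool (w = j) - of_bool (w = k) :: int)" for w
        using arg_cong[OF p(4), of "\<lambda>u. Poly_Mapping.lookup u w"] 3
        by (simp add: lookup_weight lookup_add)
      have e2: "of_bool (w = i) - of_bool (w = j) + (of_bool (w = x) - of_bool (w = y))
          = (of_bool (w = c) - of_bool (w = d) :: int)" for w
        using arg_cong[OF cd(1), of "\<lambda>u. Poly_Mapping.lookup u w"] by (simp add: lookup_weight lookup_add)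
      have "(x = j \<and> y = z \<and> v = k) \<or> (z = j \<and> v = x \<and> y = k)"
      proof -
        consider "y = z" | "v = x" | "y \<noteq> z" "v \<noteq> x" by blast
        then show ?thesis
        proof cases
          case 1
          then have "x = j" "v = k"
            using e1[of x] e1[of v] xy by (auto simp: of_bool_def split: if_splits)
          then show ?thesis using 1 by simp
        next
          case 2
          then have "z = j" "y = k"
            using e1[of z] e1[of y] xy by (auto simp: of_bool_def split: if_splits)
          then show ?thesis using 2 by simp
        next
          case 3
          then have "x = j" "x \<noteq> z"
            using e1[of x] xy by (auto simp: of_bool_def split: if_splits)
          moreover have "z = j" using e1[of z] 3 xy by (auto simp: of_bool_def split: if_splits)
          ultimately show ?thesis by simp
        qed
      qed
      moreover have False if that: "z = j" "v = x" "y = k"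
      proof -
        have "i = c" using e2[of i] xy lt that by (auto simp: of_bool_def split: if_splits)
        moreover have "x = c" using e2[of x] xy lt that by (auto simp: of_bool_def split: if_splits)
        ultimately show False using xy lt that by simp
      qed
      ultimately show ?thesis using 3 xy p(1) by (intro image_eqI[of _ _ y]) auto
    qed
  qed
qed

lemma polyL_eq:
  assumes "admissible rs ((i, j), (k, l))"
  shows "polyL rs (j, l) = (\<Sum>m = j..k. minorM rs (i, m) * minorM rs (m, l))"
proof -
  have jk: "(j, k) \<in> roots_r rs" and S: "(i, j) \<in> base rs" "(k, l) \<in> base rs"
    using assms by (auto simp: admissible_def alpha_of_def)
  have M: "(i, j) \<in> roots_m rs" "(k, l) \<in> roots_m rs"
    using S is_base_base[of rs] by (auto simp: is_base_def)
  have q: "pair_of rs (j, l) = ((i, j), (k, l))"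
    using pair_of_phi[OF assms] by (simp add: phi_of_def)
  have inj: "inj_on (\<lambda>m. (weight (j, m), weight (m, k))) {j..k}"
  proof (rule inj_onI)
    fix m m' assume "m \<in> {j..k}" "m' \<in> {j..k}"
      "(weight (j, m), weight (m, k)) = (weight (j, m'), weight (m', k))"
    then have "m \<le> k" "m' \<le> k" "weight (m, k) = weight (m', k)" by auto
    then show "m = m'" using weight_inj[of m k m' k] weight_inj[of m' k m k]
      by (cases "m = k"; cases "m' = k") auto
  qed
  have r: "root_of rs (weight (i, j) + weight (j, m)) = (i, m)"
    "root_of rs (weight (m, k) + weight (k, l)) = (m, l)" if "m \<in> {j..k}" for m
    using that roots_r_m_left[OF jk _ _ M(1), of m] roots_r_m_right[OF jk _ _ M(2), of m]
    by (auto simp: weight_add root_of_weight roots_m_pos)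
  show ?thesis
    unfolding polyL_def q Let_def decomps_eq[OF assms] sum.reindex[OF inj]
    by (intro sum.cong) (auto simp: r)
qed

end

theory Submission
  imports Defs
begin

text \<open>
  Order the variables \<open>x\<^sub>i\<^sub>j\<close> by column, and within a column from the bottom up.  The two series are triangular
  with respect to this order: each function \<open>A\<^sub>\<psi>\<close> or \<open>B\<^sub>\<psi>\<close> has the form \<open>\<alpha> x\<^sub>\<psi> + \<beta>\<close>, where \<open>\<alpha> \<noteq> 0\<close> and \<open>\<beta>\<close> are
  rational functions in variables preceding \<open>x\<^sub>\<psi>\<close>, and the roots \<open>\<psi>\<close> of the two series are pairwise different.
  A triangular family is algebraically independent, because its last member is transcendental over a
  field containing the others (\<open>triangular_alg_independent\<close>).

  Triangularity comes from two facts.  First, \<open>M\<^sub>\<gamma>\<close> is a determinant whose rows and columns are matched by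
  variables at roots, with \<open>\<gamma>\<close> at its top right corner; it is therefore nonzero and affine in \<open>x\<^sub>\<gamma>\<close> over the earlier
  variables (\<open>minorM_affine\<close>).  The polynomial \<open>L\<^sub>\<phi>\<close> inherits this, since \<open>x\<^sub>\<phi>\<close> occurs in only one of its
  summands (\<open>polyL_affine\<close>).  Secondly, \<open>L\<^sub>\<psi>\<close> is the only factor of \<open>A\<^sub>\<psi>\<close> or \<open>B\<^sub>\<psi>\<close> that involves \<open>x\<^sub>\<psi>\<close>: all the
  other factors have their corner in an earlier position (\<open>A_fun_factor\<close>, \<open>B_fun_factor\<close>).

  For the first series the second fact is visible from the rectangle that defines \<open>A\<^sub>\<psi>\<close>.  For the second
  series it rests on the closed form of the base (\<open>base_eq\<close>): if the rows of each block are numbered from the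
  bottom and the columns from the left, then row \<open>m\<close> of a block and column \<open>m\<close> of the next later block of size at
  least \<open>m\<close> carry a common root of the base, and these are all the roots of the base.
\<close>

section \<open>Polynomials and rational functions in a subset of the variables\<close>

lemma mp_over_mono: "V \<subseteq> W \<Longrightarrow> p \<in> mp_over V \<Longrightarrow> p \<in> mp_over W"
  by (auto simp: mp_over_def)

lemma mp_over_0 [simp]: "0 \<in> mp_over V"
  and mp_over_1 [simp]: "1 \<in> mp_over V"
  and mp_over_const [simp]: "mp_const c \<in> mp_over V"
  by (auto simp: mp_over_def mp_const_def)

lemma mp_over_var: "v \<in> V \<Longrightarrow> mp_var v \<in> mp_over V"
  by (simp add: mp_over_def mp_var_def)

lemma mp_over_add: "p \<in> mp_over V \<Longrightarrow> q \<in> mp_over V \<Longrightarrow> p + q \<in> mp_over V"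
  using Poly_Mapping.keys_add[of p q] by (auto simp: mp_over_def)

lemma mp_over_uminus: "p \<in> mp_over V \<Longrightarrow> - p \<in> mp_over V"
  by (simp add: mp_over_def)

lemma mp_over_mult:
  assumes "p \<in> mp_over V" "q \<in> mp_over V"
  shows "p * q \<in> mp_over V"
  unfolding mp_over_def
proof (intro CollectI ballI)
  fix m assume "m \<in> Poly_Mapping.keys (p * q)"
  then obtain a b where "m = a + b" "a \<in> Poly_Mapping.keys p" "b \<in> Poly_Mapping.keys q"
    using Poly_Mapping.keys_mult[of p q] by auto
  then show "Poly_Mapping.keys m \<subseteq> V"
    using assms Poly_Mapping.keys_add[of a b] by (fastforce simp: mp_over_def)
qed

lemma mp_over_sum: "(\<And>x. x \<in> X \<Longrightarrow> f x \<in> mp_over V) \<Longrightarrow> sum f X \<in> mp_over V"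
  by (induction X rule: infinite_finite_induct) (auto intro: mp_over_add)

lemma mp_over_prod: "(\<And>x. x \<in> X \<Longrightarrow> f x \<in> mp_over V) \<Longrightarrow> prod f X \<in> mp_over V"
  by (induction X rule: infinite_finite_induct) (auto intro: mp_over_mult)

lemma mp_over_det:
  assumes "\<And>i j. i < dim_row A \<Longrightarrow> j < dim_col A \<Longrightarrow> A $$ (i, j) \<in> mp_over V"
  shows "det A \<in> mp_over V"
proof (cases "dim_row A = dim_col A")
  case True
  then have "A $$ (i, p i) \<in> mp_over V"
    if "p permutes {0..<dim_row A}" "i \<in> {0..<dim_row A}" for p i
    using assms[of i "p i"] permutes_in_image[OF that(1), of i] that(2) True by auto
  then show ?thesis unfolding det_def
    by (auto simp: sign_def intro!: mp_over_sum mp_over_prod mp_over_uminus)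
qed (simp add: det_def)

text \<open>
  The subfield \<open>K(V)\<close> of the rational functions in the variables from \<open>V\<close>; it is
  \<open>K(m)\<close> when \<open>V\<close> consists of the roots of the nilradical.
\<close>
definition rat_over :: "'v::linorder set \<Rightarrow> ('v, 'a::field) mpoly fract set" where
  "rat_over V = {to_fract p / to_fract q |p q. p \<in> mp_over V \<and> q \<in> mp_over V \<and> q \<noteq> 0}"

lemma rat_overI:
  "p \<in> mp_over V \<Longrightarrow> q \<in> mp_over V \<Longrightarrow> q \<noteq> 0 \<Longrightarrow> to_fract p / to_fract q \<in> rat_over V"
  unfolding rat_over_def by blast

lemma rat_overE:
  assumes "x \<in> rat_over V"
  obtains p q where "x = to_fract p / to_fract q" "p \<in> mp_over V" "q \<in> mp_over V" "q \<noteq> 0"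
  using assms unfolding rat_over_def by blast

lemma rat_over_to_fract: "p \<in> mp_over V \<Longrightarrow> to_fract p \<in> rat_over V"
  using rat_overI[of p V 1] by simp

lemma rat_over_0 [simp]: "0 \<in> rat_over V"
  and rat_over_1 [simp]: "1 \<in> rat_over V"
  using rat_over_to_fract[of 0 V] rat_over_to_fract[of 1 V] by simp_all

lemma rat_over_mono: "V \<subseteq> W \<Longrightarrow> x \<in> rat_over V \<Longrightarrow> x \<in> rat_over W"
  by (elim rat_overE) (auto intro!: rat_overI intro: mp_over_mono)

lemma rat_over_add:
  assumes "x \<in> rat_over V" "y \<in> rat_over V"
  shows "x + y \<in> rat_over V"
proof -
  obtain p q p' q' where x: "x = to_fract p / to_fract q" "p \<in> mp_over V" "q \<in> mp_over V" "q \<noteq> 0"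
    and y: "y = to_fract p' / to_fract q'" "p' \<in> mp_over V" "q' \<in> mp_over V" "q' \<noteq> 0"
    using assms by (elim rat_overE)
  have "to_fract (p * q' + p' * q) / to_fract (q * q') \<in> rat_over V"
    using x y by (intro rat_overI mp_over_add mp_over_mult) auto
  then show ?thesis
    using x(4) y(4) by (simp add: x(1) y(1) add_frac_eq)
qed

lemma rat_over_mult:
  assumes "x \<in> rat_over V" "y \<in> rat_over V"
  shows "x * y \<in> rat_over V"
proof -
  obtain p q p' q' where x: "x = to_fract p / to_fract q" "p \<in> mp_over V" "q \<in> mp_over V" "q \<noteq> 0"
    and y: "y = to_fract p' / to_fract q'" "p' \<in> mp_over V" "q' \<in> mp_over V" "q' \<noteq> 0"
    using assms by (elim rat_overE)
  have "to_fract (p * p') / to_fract (q * q') \<in> rat_over V"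
    using x y by (intro rat_overI mp_over_mult) auto
  then show ?thesis
    by (simp add: x(1) y(1))
qed

lemma rat_over_divide:
  assumes "x \<in> rat_over V" "y \<in> rat_over V"
  shows "x / y \<in> rat_over V"
proof (cases "y = 0")
  case False
  obtain p q where y: "y = to_fract p / to_fract q" "p \<in> mp_over V" "q \<in> mp_over V" "q \<noteq> 0"
    using assms(2) by (elim rat_overE)
  then have "inverse y = to_fract q / to_fract p" "p \<noteq> 0" using False by auto
  then have "inverse y \<in> rat_over V" using y by (auto intro: rat_overI)
  then show ?thesis using assms(1) by (simp add: divide_inverse rat_over_mult)
qed simp

lemma rat_over_prod: "(\<And>x. x \<in> X \<Longrightarrow> f x \<in> rat_over V) \<Longrightarrow> prod f X \<in> rat_over V"
  by (induction X rule: infinite_finite_induct) (auto intro: rat_over_mult)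

lemma rat_over_sum: "(\<And>x. x \<in> X \<Longrightarrow> f x \<in> rat_over V) \<Longrightarrow> sum f X \<in> rat_over V"
  by (induction X rule: infinite_finite_induct) (auto intro: rat_over_add)

lemma rat_over_power: "x \<in> rat_over V \<Longrightarrow> x ^ n \<in> rat_over V"
  by (induction n) (auto intro: rat_over_mult)

section \<open>Algebraic independence of triangular families\<close>

lemma mp_var_power: "mp_var v ^ n = Poly_Mapping.single (Poly_Mapping.single v n) 1"
  by (induction n) (simp_all add: mp_var_def mult_single flip: single_add)

lemma lookup_mult_var_power:
  fixes p :: "('v, 'a::comm_ring_1) mpoly"
  assumes "p \<in> mp_over V" "v \<notin> V" "Poly_Mapping.keys m \<subseteq> V"
  shows "Poly_Mapping.lookup (p * mp_var v ^ n) (m + Poly_Mapping.single v k)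
    = (if k = n then Poly_Mapping.lookup p m else 0)"
proof -
  let ?L = "Poly_Mapping.lookup" and ?v = "Poly_Mapping.single v"
  have p: "p = (\<Sum>l\<in>Poly_Mapping.keys p. Poly_Mapping.single l (?L p l))"
    by (rule poly_mapping_eqI) (simp add: lookup_sum lookup_single when_def in_keys_iff)
  have v: "?L l v = 0" if "Poly_Mapping.keys l \<subseteq> V" for l
    using that assms(2) by (auto simp: in_keys_iff)
  have eq: "l + ?v n = m + ?v k \<longleftrightarrow> l = m \<and> k = n" if "l \<in> Poly_Mapping.keys p" for l
  proof
    assume e: "l + ?v n = m + ?v k"
    have "Poly_Mapping.keys l \<subseteq> V" using assms(1) that by (auto simp: mp_over_def)
    then have "k = n"
      using arg_cong[OF e, of "\<lambda>u. ?L u v"] v[of l] v[of m] assms(3) by (simp add: lookup_add)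
    then show "l = m \<and> k = n" using e by simp
  qed simp
  have "?L (p * mp_var v ^ n) (m + ?v k)
      = (\<Sum>l\<in>Poly_Mapping.keys p. ?L p l when l + ?v n = m + ?v k)"
    by (subst p) (simp add: sum_distrib_right mp_var_power mult_single lookup_sum lookup_single)
  also have "\<dots> = (\<Sum>l\<in>Poly_Mapping.keys p. ?L p l when l = m \<and> k = n)"
    by (intro sum.cong) (simp_all add: eq)
  also have "\<dots> = (if k = n then ?L p m else 0)"
    by (simp add: when_def in_keys_iff)
  finally show ?thesis .
qed

text \<open>
  Multiplication by \<open>x\<^sub>v ^ n\<close> shifts the exponent of \<open>v\<close> from 0 to \<open>n\<close>,
  so the monomials of the summands cannot meet for different \<open>n\<close> and nothing cancels.
\<close>
lemma mp_var_transcendental_mp_over: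
  fixes a :: "nat \<Rightarrow> ('v, 'a::comm_ring_1) mpoly"
  assumes "v \<notin> V" "\<And>d. d \<le> N \<Longrightarrow> a d \<in> mp_over V"
    and zero: "(\<Sum>d\<le>N. a d * mp_var v ^ d) = 0" and "k \<le> N"
  shows "a k = 0"
proof (rule poly_mapping_eqI)
  fix m
  show "Poly_Mapping.lookup (a k) m = Poly_Mapping.lookup 0 m"
  proof (cases "Poly_Mapping.keys m \<subseteq> V")
    case True
    have "0 = Poly_Mapping.lookup (\<Sum>d\<le>N. a d * mp_var v ^ d) (m + Poly_Mapping.single v k)"
      by (simp add: zero)
    also have "\<dots> = (\<Sum>d\<le>N. if k = d then Poly_Mapping.lookup (a d) m else 0)"
      unfolding lookup_sum
      by (intro sum.cong refl lookup_mult_var_power[OF assms(2) assms(1) True]) simp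
    also have "\<dots> = Poly_Mapping.lookup (a k) m" using \<open>k \<le> N\<close> by simp
    finally show ?thesis by simp
  next
    case False
    then show ?thesis using assms(2)[OF \<open>k \<le> N\<close>] by (auto simp: mp_over_def in_keys_iff)
  qed
qed

text \<open>
  Clearing denominators reduces transcendence of a variable over a field of rational functions to
  transcendence over a polynomial ring.
\<close>
lemma rat_over_common_denominator:
  assumes "finite D" "\<And>d. d \<in> D \<Longrightarrow> c d \<in> rat_over V"
  obtains q where "q \<in> mp_over V" "q \<noteq> 0" "\<And>d. d \<in> D \<Longrightarrow> to_fract q * c d \<in> to_fract ` mp_over V"
proof -
  have "\<exists>q\<in>mp_over V. q \<noteq> 0 \<and> (\<forall>d\<in>D. to_fract q * c d \<in> to_fract ` mp_over V)"
    using assms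
  proof (induction D rule: finite_induct)
    case (insert x D)
    then obtain q where q: "q \<in> mp_over V" "q \<noteq> 0" "\<forall>d\<in>D. to_fract q * c d \<in> to_fract ` mp_over V"
      by auto
    obtain r s where rs: "c x = to_fract r / to_fract s" "r \<in> mp_over V" "s \<in> mp_over V" "s \<noteq> 0"
      using insert.prems[of x] by (auto elim: rat_overE)
    have "to_fract (s * q) * c d \<in> to_fract ` mp_over V" if d: "d \<in> insert x D" for d
    proof (cases "d = x")
      case True
      have "to_fract (s * q) * c d = to_fract (q * r)"
        using rs(4) by (simp add: True rs(1))
      then show ?thesis by (rule image_eqI) (intro mp_over_mult q(1) rs(2))
    next
      case False
      then obtain u where u: "u \<in> mp_over V" "to_fract q * c d = to_fract u" using q(3) d by auto
      have "to_fract (s * q) * c d = to_fract (s * u)"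
        by (simp add: mult.assoc u(2))
      then show ?thesis by (rule image_eqI) (intro mp_over_mult u(1) rs(3))
    qed
    moreover have "s * q \<in> mp_over V" "s * q \<noteq> 0"
      using q(1,2) rs(3,4) by (simp_all add: mp_over_mult)
    ultimately show ?case by blast
  qed (auto intro: bexI[of _ 1])
  then show thesis using that by blast
qed

lemma mp_var_transcendental:
  fixes P :: "('v::linorder, 'a::field) mpoly fract poly"
  assumes "v \<notin> V" "\<And>d. coeff P d \<in> rat_over V" "poly P (to_fract (mp_var v)) = 0"
  shows "P = 0"
proof -
  have "\<And>d. d \<in> {..degree P} \<Longrightarrow> coeff P d \<in> rat_over V" using assms(2) by blast
  then obtain q where q: "q \<noteq> 0" "\<And>d. d \<in> {..degree P} \<Longrightarrow> to_fract q * coeff P d \<in> to_fract ` mp_over V"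
    using rat_over_common_denominator[OF finite_atMost, of "degree P" "coeff P" V] by metis
  have "\<forall>d. \<exists>r. d \<le> degree P \<longrightarrow> r \<in> mp_over V \<and> to_fract q * coeff P d = to_fract r"
    using q(2) by blast
  then obtain a where a: "\<And>d. d \<le> degree P \<Longrightarrow> a d \<in> mp_over V"
    "\<And>d. d \<le> degree P \<Longrightarrow> to_fract q * coeff P d = to_fract (a d)"
    by metis
  have pow: "to_fract (x ^ n) = to_fract x ^ n" for x :: "('v, 'a) mpoly" and n
    by (induction n) simp_all
  have "to_fract (\<Sum>d\<le>degree P. a d * mp_var v ^ d)
      = (\<Sum>d\<le>degree P. to_fract q * coeff P d * to_fract (mp_var v) ^ d)"
    by (simp add: a(2) pow)
  also have "\<dots> = to_fract q * poly P (to_fract (mp_var v))"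
    by (simp add: poly_altdef sum_distrib_left mult.assoc)
  finally have zero: "(\<Sum>d\<le>degree P. a d * mp_var v ^ d) = 0"
    by (simp only: assms(3) mult_zero_right to_fract_eq_0_iff)
  have "a (degree P) = 0"
    by (rule mp_var_transcendental_mp_over[OF assms(1) _ zero]) (simp_all add: a(1))
  then have "to_fract q * lead_coeff P = 0" using a(2)[of "degree P"] by simp
  then show ?thesis using q(1) by simp
qed

text \<open>
  Substituting an affine function with nonzero slope into a nonzero polynomial leaves it nonzero, so an
  affine function of a transcendental element is transcendental.
\<close>
lemma affine_transcendental:
  fixes P :: "('v::linorder, 'a::field) mpoly fract poly"
  assumes "v \<notin> V" "\<And>d. coeff P d \<in> rat_over V"
    and "\<alpha> \<in> rat_over V" "\<beta> \<in> rat_over V" "\<alpha> \<noteq> 0"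
    and "poly P (\<alpha> * to_fract (mp_var v) + \<beta>) = 0"
  shows "P = 0"
proof -
  have "coeff (pcompose P [:\<beta>, \<alpha>:]) d \<in> rat_over V" for d
    using assms(2-4)
    by (intro coeff_pcompose_semiring_closed)
      (auto simp: coeff_pCons intro: rat_over_add rat_over_mult split: nat.splits)
  moreover have "poly (pcompose P [:\<beta>, \<alpha>:]) (to_fract (mp_var v)) = 0"
    using assms(6) by (simp add: poly_pcompose algebra_simps)
  ultimately have "pcompose P [:\<beta>, \<alpha>:] = 0"
    by (rule mp_var_transcendental[OF assms(1)])
  then show ?thesis using assms(5) by (simp add: pcompose_eq_0_iff)
qed

definition below :: "('v \<Rightarrow> 'o::linorder) \<Rightarrow> 'v \<Rightarrow> 'v set" where
  "below \<rho> v = {u. \<rho> u < \<rho> v}"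

text \<open>
  Being affine with nonzero slope in the variable \<open>v\<close>, over the field generated by the variables of
  strictly smaller rank: the shape that makes a family triangular.
\<close>
definition affine_in :: "('v::linorder \<Rightarrow> 'o::linorder) \<Rightarrow> 'v \<Rightarrow> ('v, 'a::field) mpoly fract \<Rightarrow> bool" where
  "affine_in \<rho> v f \<longleftrightarrow> (\<exists>\<alpha>\<in>rat_over (below \<rho> v). \<exists>\<beta>\<in>rat_over (below \<rho> v).
     \<alpha> \<noteq> 0 \<and> f = \<alpha> * to_fract (mp_var v) + \<beta>)"

text \<open>
  The reason for independence: in a triangular family the member with the largest leading variable is
  transcendental over a field containing all other members.  Hence a relation, read as a polynomial
  in that member, has vanishing coefficients, and these are relations between fewer members.
  A relation is indexed by an arbitrary finite set \<open>T\<close> carrying exponent vectors \<open>e\<close> that separate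
  its elements, rather than by monomials: the coefficient relation is then the restriction to
  the subset of \<open>T\<close> with a fixed exponent of the removed member, and no polynomial has to be rebuilt.
\<close>
lemma triangular_monomials_independent:
  fixes f :: "'i \<Rightarrow> ('v::linorder, 'a::field) mpoly fract"
    and e :: "'x \<Rightarrow> 'i \<Rightarrow> nat" and c :: "'x \<Rightarrow> 'a"
  assumes "finite I" "finite T"
    and aff: "\<And>i. i \<in> I \<Longrightarrow> affine_in \<rho> (v i) (f i)"
    and inj: "inj_on (\<lambda>i. \<rho> (v i)) I"
    and sep: "\<And>x y. x \<in> T \<Longrightarrow> y \<in> T \<Longrightarrow> (\<And>i. i \<in> I \<Longrightarrow> e x i = e y i) \<Longrightarrow> x = y"
    and zero: "(\<Sum>x\<in>T. to_fract (mp_const (c x)) * (\<Prod>i\<in>I. f i ^ e x i)) = 0"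
    and "x \<in> T"
  shows "c x = 0"
  using \<open>finite I\<close> \<open>finite T\<close> aff inj sep zero \<open>x \<in> T\<close>
proof (induction I arbitrary: T rule: finite_ranking_induct[where f = "\<lambda>i. \<rho> (v i)"])
  case empty
  then have "T = {x}" by auto
  then have "Poly_Mapping.single 0 (c x) = (0 :: ('v, 'a) mpoly)"
    using empty.prems(5) by (simp add: mp_const_def)
  then show ?case by (metis lookup_single_eq lookup_zero)
next
  case (insert j I)
  show ?case
  proof (cases "j \<in> I")
    case True
    then have "insert j I = I" by (rule insert_absorb)
    note prems = insert.prems[unfolded this]
    show ?thesis by (rule insert.IH[OF prems])
  next
    case False
    have less: "\<rho> (v i) < \<rho> (v j)" if "i \<in> I" for i
      using insert.hyps(2)[OF that] insert.prems(3) False that by (auto simp: inj_on_def order_less_le)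
    let ?V = "below \<rho> (v j)"
    let ?t = "\<lambda>x. to_fract (mp_const (c x)) * (\<Prod>i\<in>I. f i ^ e x i)"
    have f: "f i \<in> rat_over ?V" if i: "i \<in> I" for i
    proof -
      have sub: "below \<rho> (v i) \<subseteq> ?V" and vi: "v i \<in> ?V" using less[OF i] by (auto simp: below_def)
      obtain \<alpha> \<beta> where "\<alpha> \<in> rat_over (below \<rho> (v i))" "\<beta> \<in> rat_over (below \<rho> (v i))"
        "f i = \<alpha> * to_fract (mp_var (v i)) + \<beta>"
        using insert.prems(2)[of i] i unfolding affine_in_def by auto
      then show ?thesis
        using rat_over_mono[OF sub, of \<alpha>] rat_over_mono[OF sub, of \<beta>]
        by (simp add: rat_over_add rat_over_mult rat_over_to_fract mp_over_var vi)
    qed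
    define P where "P = (\<Sum>x\<in>T. monom (?t x) (e x j))"
    have "coeff P d \<in> rat_over ?V" for d
      unfolding P_def coeff_sum coeff_monom
      by (intro rat_over_sum) (auto intro!: rat_over_mult rat_over_to_fract rat_over_prod rat_over_power f)
    moreover have "poly P (f j) = 0"
      unfolding P_def poly_sum poly_monom
      using insert.prems(5) insert.hyps(1) False by (simp add: mult.assoc mult.commute[of "f j ^ _"])
    moreover obtain \<alpha> \<beta> where "\<alpha> \<in> rat_over ?V" "\<beta> \<in> rat_over ?V" "\<alpha> \<noteq> 0"
      "f j = \<alpha> * to_fract (mp_var (v j)) + \<beta>"
      using insert.prems(2)[of j] unfolding affine_in_def by auto
    ultimately have P: "P = 0"
      using affine_transcendental[of "v j" ?V P \<alpha> \<beta>] by (auto simp: below_def)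
    \<comment> \<open>The relation among the remaining members: the coefficient at the exponent that \<open>x\<close> has at \<open>j\<close>.\<close>
    define T' where "T' = {y \<in> T. e y j = e x j}"
    have "(\<Sum>y\<in>T'. ?t y) = coeff P (e x j)"
      unfolding P_def coeff_sum coeff_monom T'_def using insert.prems(1)
      by (simp add: sum.If_cases Int_def)
    then have "(\<Sum>y\<in>T'. ?t y) = 0" by (simp add: P)
    then show ?thesis
    proof (rule insert.IH[of T', rotated 4])
      show "a = b" if "a \<in> T'" "b \<in> T'" "\<And>i. i \<in> I \<Longrightarrow> e a i = e b i" for a b
        by (rule insert.prems(4)) (use that in \<open>auto simp: T'_def\<close>)
    qed (use insert.prems(1-3,6) in \<open>auto simp: T'_def inj_on_def\<close>)
  qed
qed

lemma triangular_alg_independent: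
  fixes f :: "'i \<Rightarrow> 'a::field ratfun"
  assumes "finite I" "\<And>i. i \<in> I \<Longrightarrow> affine_in \<rho> (v i) (f i)" "inj_on (\<lambda>i. \<rho> (v i)) I"
  shows "alg_independent I f"
  unfolding alg_independent_def
proof (intro allI impI)
  fix p :: "('i, 'a) mpoly"
  assume p: "p \<in> mp_over I" and zero: "mp_eval (\<lambda>c. to_fract (mp_const c)) f p = 0"
  let ?L = "Poly_Mapping.lookup"
  have keys: "Poly_Mapping.keys m \<subseteq> I" if "m \<in> Poly_Mapping.keys p" for m
    using p that by (auto simp: mp_over_def)
  have prod: "(\<Prod>i\<in>I. f i ^ ?L m i) = (\<Prod>i\<in>Poly_Mapping.keys m. f i ^ ?L m i)"
    if "m \<in> Poly_Mapping.keys p" for m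
    using keys[OF that] assms(1) by (intro prod.mono_neutral_right) (auto simp: in_keys_iff)
  have "?L p m = 0" if "m \<in> Poly_Mapping.keys p" for m
  proof (rule triangular_monomials_independent[OF assms(1) _ assms(2,3), of "Poly_Mapping.keys p" ?L])
    show "x = y" if "x \<in> Poly_Mapping.keys p" "y \<in> Poly_Mapping.keys p"
      "\<And>i. i \<in> I \<Longrightarrow> ?L x i = ?L y i" for x y
    proof (rule poly_mapping_eqI)
      show "?L x k = ?L y k" for k
        using keys[OF that(1)] keys[OF that(2)] that(3)[of k]
        by (cases "k \<in> I") (auto simp: in_keys_iff subset_iff dest!: spec[of _ k])
    qed
    show "(\<Sum>m\<in>Poly_Mapping.keys p. to_fract (mp_const (?L p m)) * (\<Prod>i\<in>I. f i ^ ?L m i)) = 0"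
      using zero by (simp add: mp_eval_def prod)
  qed (use that in auto)
  then show "p = 0" by (metis in_keys_iff keys_eq_empty all_not_in_conv)
qed

section \<open>The polynomials M and L as affine functions of their corner variable\<close>

definition gen_entry :: "root set \<Rightarrow> root \<Rightarrow> (nat \<times> nat, 'a::comm_ring_1) mpoly" where
  "gen_entry R \<gamma> = (if \<gamma> \<in> R then mp_var \<gamma> else 0)"

lemma gen_entry_mp_over: "(\<gamma> \<in> R \<Longrightarrow> \<gamma> \<in> V) \<Longrightarrow> gen_entry R \<gamma> \<in> mp_over V"
  by (simp add: gen_entry_def mp_over_var)

lemma affine_mp_var_nonzero:
  fixes c d :: "('v, 'a::comm_ring_1) mpoly"
  assumes "c \<in> mp_over V" "d \<in> mp_over V" "v \<notin> V" "c \<noteq> 0"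
  shows "c * mp_var v + d \<noteq> 0"
proof
  assume "c * mp_var v + d = 0"
  then have "(\<Sum>n\<le>1. (if n = 0 then d else c) * mp_var v ^ n) = 0" by (simp add: add.commute)
  moreover have "(if n = 0 then d else c) \<in> mp_over V" for n :: nat using assms by simp
  ultimately have "(if (1::nat) = 0 then d else c) = 0"
    by (intro mp_var_transcendental_mp_over[OF assms(3), of 1 "\<lambda>n. if n = 0 then d else c" 1]) simp_all
  then have "c = 0" by simp
  then show False using assms(4) by simp
qed

lemma grid_remove_subset:
  assumes "x \<notin> A" "A \<subseteq> B"
  shows "R \<inter> (A \<times> C) \<subseteq> R \<inter> (B \<times> C) - {(x, b)}"
  using assms by auto

text \<open>
  Expansion along the first row.  The variable \<open>(r 0, b)\<close> occurs only in that row, so the determinant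
  is affine in it and the slope is a cofactor.  This cofactor is again the determinant of a matrix of variables
  and zeros whose rows and columns are matched by variables, namely by \<open>T\<close> without \<open>(r 0, b)\<close>;
  by induction it is affine with nonzero slope in another variable, hence nonzero.
  Rows and columns are kept as injective index functions, so that deleting a row and a column stays inside
  the class of matrices considered.
\<close>
lemma det_matching_affine:
  fixes r c :: "nat \<Rightarrow> nat" and R T :: "root set"
  assumes "inj_on r {..k}" "inj_on c {..k}"
    and "T \<subseteq> R" "inj_on fst T" "inj_on snd T" "fst ` T = r ` {..k}" "snd ` T = c ` {..k}"
    and "(r 0, b) \<in> T"
  shows "\<exists>p q. p \<in> mp_over (R \<inter> (r ` {1..k} \<times> c ` {..k})) \<and>
    q \<in> mp_over (R \<inter> (r ` {..k} \<times> c ` {..k}) - {(r 0, b)}) \<and>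
    p \<noteq> 0 \<and> det (mat (Suc k) (Suc k) (\<lambda>(i, j). gen_entry R (r i, c j)) :: (nat \<times> nat, 'a::idom) mpoly mat)
      = p * mp_var (r 0, b) + q"
  using assms
proof (induction k arbitrary: r c T b)
  case 0
  then have b: "b = c 0" by force
  let ?A = "mat 1 1 (\<lambda>(i, j). gen_entry R (r i, c j)) :: (nat \<times> nat, 'a) mpoly mat"
  have "det ?A = ?A $$ (0, 0)"
    by (rule det_single) simp
  also have "\<dots> = 1 * mp_var (r 0, b) + 0" using 0 by (auto simp: gen_entry_def b)
  finally show ?case by (intro exI[of _ 1] exI[of _ 0]) simp
next
  case (Suc k)
  let ?n = "Suc (Suc k)"
  let ?A = "mat ?n ?n (\<lambda>(i, j). gen_entry R (r i, c j)) :: (nat \<times> nat, 'a) mpoly mat"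
  \<comment> \<open>The row and column labels left after deleting row \<open>0\<close> and column \<open>j0\<close>.\<close>
  define r' where "r' i = r (Suc i)" for i
  define c' where "c' j0 j = (if j < j0 then c j else c (Suc j))" for j0 j
  have del: "mat_delete ?A 0 j = mat (Suc k) (Suc k) (\<lambda>(i, l). gen_entry R (r' i, c' j l))"
    if "j < ?n" for j
    unfolding mat_delete_def r'_def c'_def by (rule eq_matI) auto
  obtain j0 where j0: "j0 \<le> Suc k" "b = c j0"
    using Suc.prems(7,8) by (force simp: image_iff)
  have r'_img: "r' ` {..k} = r ` {1..Suc k}"
  proof -
    have "r' ` {..k} = r ` (Suc ` {..k})" by (auto simp: r'_def)
    also have "Suc ` {..k} = {1..Suc k}" by (rule image_Suc_atMost)
    finally show ?thesis .
  qed
  have c'_img: "c' j ` {..k} = c ` ({..Suc k} - {j})" if "j \<le> Suc k" for j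
  proof -
    have "c' j ` {..k} = c ` ((\<lambda>l. if l < j then l else Suc l) ` {..k})"
      by (auto simp: c'_def image_iff)
    also have "(\<lambda>l. if l < j then l else Suc l) ` {..k} = {..Suc k} - {j}"
    proof (intro equalityI subsetI)
      fix x assume "x \<in> {..Suc k} - {j}"
      then show "x \<in> (\<lambda>l. if l < j then l else Suc l) ` {..k}"
        using that by (cases "x < j") (auto intro: image_eqI[of _ _ x] image_eqI[of _ _ "x - 1"])
    qed auto
    finally show ?thesis .
  qed
  have cof: "cofactor ?A 0 j \<in> mp_over (R \<inter> (r ` {1..Suc k} \<times> c ` {..Suc k}))" if "j \<le> Suc k" for j
  proof -
    have "det (mat_delete ?A 0 j) \<in> mp_over (R \<inter> (r ` {1..Suc k} \<times> c ` {..Suc k}))"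
    proof (subst del)
      have "r' i \<in> r ` {1..Suc k}" "c' j l \<in> c ` {..Suc k}" if "i < Suc k" "l < Suc k" for i l
      proof -
        have "r' i \<in> r' ` {..k}" "c' j l \<in> c' j ` {..k}" using that by auto
        then show "r' i \<in> r ` {1..Suc k}" "c' j l \<in> c ` {..Suc k}"
          unfolding r'_img c'_img[OF \<open>j \<le> Suc k\<close>] by auto
      qed
      then show "det (mat (Suc k) (Suc k) (\<lambda>(i, l). gen_entry R (r' i, c' j l)))
          \<in> mp_over (R \<inter> (r ` {1..Suc k} \<times> c ` {..Suc k}))"
        by (intro mp_over_det) (auto intro!: gen_entry_mp_over)
    qed (use that in simp)
    then show ?thesis by (cases "even j") (auto simp: cofactor_def intro: mp_over_uminus)
  qed
  have "det (mat_delete ?A 0 j0) \<noteq> 0"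
  proof -
    let ?T = "T - {(r 0, b)}"
    have fT: "fst ` ?T = r' ` {..k}"
    proof -
      have "fst ` ?T = fst ` T - {r 0}" 
        using Suc.prems(4,8) by (subst inj_on_image_set_diff[OF Suc.prems(4)]) auto
      also have "\<dots> = r ` ({..Suc k} - {0})"
        using Suc.prems(1,6) by (subst inj_on_image_set_diff[OF Suc.prems(1)]) auto
      also have "{..Suc k} - {0} = {1..Suc k}" by auto
      finally show ?thesis by (simp add: r'_img)
    qed
    have sT: "snd ` ?T = c' j0 ` {..k}"
    proof -
      have "snd ` ?T = snd ` T - {b}" 
        using Suc.prems(5,8) by (subst inj_on_image_set_diff[OF Suc.prems(5)]) auto
      also have "\<dots> = c ` ({..Suc k} - {j0})"
        using Suc.prems(2,7) j0 by (subst inj_on_image_set_diff[OF Suc.prems(2)]) auto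
      finally show ?thesis by (simp add: c'_img[OF j0(1)])
    qed
    have "r' 0 \<in> fst ` ?T" unfolding fT by auto
    then have "\<exists>b'. (r' 0, b') \<in> ?T" by (metis imageE prod.collapse)
    then obtain b' where b': "(r' 0, b') \<in> ?T" by blast
    have inj: "inj_on r' {..k}" "inj_on (c' j0) {..k}"
    proof -
      show "inj_on r' {..k}" using Suc.prems(1) by (auto simp: inj_on_def r'_def)
      have "card (c' j0 ` {..k}) = card ({..Suc k} - {j0})"
        unfolding c'_img[OF j0(1)] by (rule card_image[OF inj_on_diff[OF Suc.prems(2)]])
      then show "inj_on (c' j0) {..k}" using j0(1) by (intro eq_card_imp_inj_on) simp_all
    qed
    let ?A' = "mat (Suc k) (Suc k) (\<lambda>(i, l). gen_entry R (r' i, c' j0 l)) :: (nat \<times> nat, 'a) mpoly mat"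
    have T: "?T \<subseteq> R" "inj_on fst ?T" "inj_on snd ?T"
      using Suc.prems(3) inj_on_diff[OF Suc.prems(4)] inj_on_diff[OF Suc.prems(5)] by blast+
    note IH = Suc.IH[OF inj T fT sT b']
    obtain p q where pq: "p \<in> mp_over (R \<inter> (r' ` {1..k} \<times> c' j0 ` {..k}))"
      "q \<in> mp_over (R \<inter> (r' ` {..k} \<times> c' j0 ` {..k}) - {(r' 0, b')})" "p \<noteq> 0"
      "det ?A' = p * mp_var (r' 0, b') + q"
      using IH by (elim exE conjE) (rule that)
    have "r' 0 \<notin> r' ` {1..k}" using inj_onD[OF inj(1), of 0] by fastforce
    then have sub: "R \<inter> (r' ` {1..k} \<times> c' j0 ` {..k}) \<subseteq> R \<inter> (r' ` {..k} \<times> c' j0 ` {..k}) - {(r' 0, b')}"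
      by (rule grid_remove_subset) (auto intro!: image_mono)
    have "p * mp_var (r' 0, b') + q \<noteq> 0"
      by (rule affine_mp_var_nonzero[OF mp_over_mono[OF sub pq(1)] pq(2) _ pq(3)]) simp
    moreover have "mat_delete ?A 0 j0 = ?A'" by (rule del) (use j0(1) in simp)
    ultimately show ?thesis using pq(4) by simp
  qed
  then have nz: "cofactor ?A 0 j0 \<noteq> 0" by (simp add: cofactor_def)
  have "det ?A = (\<Sum>j<?n. ?A $$ (0, j) * cofactor ?A 0 j)"
    by (rule laplace_expansion_row[of _ ?n]) auto
  also have "\<dots> = ?A $$ (0, j0) * cofactor ?A 0 j0
      + (\<Sum>j\<in>{..<?n} - {j0}. ?A $$ (0, j) * cofactor ?A 0 j)"
    using j0 by (intro sum.remove) auto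
  also have "?A $$ (0, j0) = mp_var (r 0, b)"
    using j0 Suc.prems(3,8) by (auto simp: gen_entry_def)
  finally have det: "det ?A = cofactor ?A 0 j0 * mp_var (r 0, b)
      + (\<Sum>j\<in>{..<?n} - {j0}. ?A $$ (0, j) * cofactor ?A 0 j)"
    by (simp only: mult.commute)
  have r0: "r 0 \<notin> r ` {1..Suc k}" using inj_onD[OF Suc.prems(1), of 0] by fastforce
  have "?A $$ (0, j) * cofactor ?A 0 j \<in> mp_over (R \<inter> (r ` {..Suc k} \<times> c ` {..Suc k}) - {(r 0, b)})"
    if j: "j \<in> {..<?n} - {j0}" for j
  proof (rule mp_over_mult)
    have "c j \<noteq> b" using Suc.prems(2) j j0 by (auto simp: inj_on_def)
    then show "?A $$ (0, j) \<in> mp_over (R \<inter> (r ` {..Suc k} \<times> c ` {..Suc k}) - {(r 0, b)})"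
      using j by (auto intro!: gen_entry_mp_over)
    show "cofactor ?A 0 j \<in> mp_over (R \<inter> (r ` {..Suc k} \<times> c ` {..Suc k}) - {(r 0, b)})"
    proof (rule mp_over_mono[OF _ cof])
      show "R \<inter> (r ` {1..Suc k} \<times> c ` {..Suc k}) \<subseteq> R \<inter> (r ` {..Suc k} \<times> c ` {..Suc k}) - {(r 0, b)}"
        by (rule grid_remove_subset[OF r0]) (auto intro!: image_mono)
    qed (use j in simp)
  qed
  then have "(\<Sum>j\<in>{..<?n} - {j0}. ?A $$ (0, j) * cofactor ?A 0 j)
      \<in> mp_over (R \<inter> (r ` {..Suc k} \<times> c ` {..Suc k}) - {(r 0, b)})"
    by (rule mp_over_sum)
  then show ?case
    by (intro exI conjI) (rule cof[OF j0(1)], assumption, rule nz, rule det)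
qed

lemma base_subset_roots_m: "base rs \<subseteq> roots_m rs"
  using is_base_base[of rs] by (simp add: is_base_def)

lemma finite_roots_m: "finite (roots_m rs)"
  by (rule finite_subset[of _ "{..sum_list rs} \<times> {..sum_list rs}"])
    (auto simp: roots_m_def pos_roots_def)

lemma finite_base: "finite (base rs)"
  using base_subset_roots_m finite_roots_m by (rule finite_subset)

lemma inj_on_pred:
  assumes "Z \<subseteq> {1..n}"
  shows "inj_on (\<lambda>i::nat. i - 1) Z"
proof (rule inj_onI)
  fix i j assume "i \<in> Z" "j \<in> Z" and eq: "i - 1 = j - 1"
  then have "1 \<le> i" "1 \<le> j" using assms by auto
  then show "i = j" using eq by linarith
qed

lemma submatrix_gen_mat:
  assumes "X \<subseteq> {1..sum_list rs}" "Y \<subseteq> {1..sum_list rs}"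
  shows "submatrix (gen_mat rs) ((\<lambda>i. i - 1) ` X) ((\<lambda>j. j - 1) ` Y)
    = mat (card X) (card Y) (\<lambda>(i, j). gen_entry (roots_m rs)
        (Suc (pick ((\<lambda>i. i - 1) ` X) i), Suc (pick ((\<lambda>j. j - 1) ` Y) j)))"
proof -
  let ?n = "sum_list rs"
  have *: "{i. i < ?n \<and> i \<in> (\<lambda>i. i - 1) ` Z} = (\<lambda>i. i - 1) ` Z"
    "card ((\<lambda>i. i - 1) ` Z) = card Z" if "Z \<subseteq> {1..?n}" for Z
  proof -
    have "i - 1 < ?n" if "i \<in> Z" for i
      using subsetD[OF \<open>Z \<subseteq> {1..?n}\<close> that] by auto
    then show "{i. i < ?n \<and> i \<in> (\<lambda>i. i - 1) ` Z} = (\<lambda>i. i - 1) ` Z" by blast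
    show "card ((\<lambda>i. i - 1) ` Z) = card Z"
      by (rule card_image[OF inj_on_pred[OF that]])
  qed
  have p: "pick ((\<lambda>i. i - 1) ` Z) i < ?n" if "Z \<subseteq> {1..?n}" "i < card Z" for Z i
    using pick_le[of i ?n "(\<lambda>i. i - 1) ` Z"] *[OF that(1)] that(2) by simp
  have dim: "dim_row (gen_mat rs) = ?n" "dim_col (gen_mat rs) = ?n" by (simp_all add: gen_mat_def)
  show ?thesis
    unfolding submatrix_def dim *[OF assms(1)] *[OF assms(2)]
    by (rule cong_mat) (simp_all add: p[OF assms(1), simplified] p[OF assms(2), simplified] gen_mat_def gen_entry_def)
qed

text \<open>
  The roots of the base inside \<open>(a, b)\<close>, together with \<open>(a, b)\<close> itself, match the rows of the minor with
  its columns.  All other rows lie below row \<open>a\<close> and all other columns to the left of column \<open>b\<close>, which gives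
  the location of the variables.
\<close>
lemma minorM_affine:
  assumes "(a, b) \<in> roots_m rs"
  shows "\<exists>p q. p \<in> mp_over (roots_m rs \<inter> {(i, j). a < i \<and> j \<le> b}) \<and>
    q \<in> mp_over (roots_m rs \<inter> {(i, j). a \<le> i \<and> j \<le> b} - {(a, b)}) \<and>
    p \<noteq> 0 \<and> (minorM rs (a, b) :: (nat \<times> nat, 'a::idom) mpoly) = p * mp_var (a, b) + q"
proof -
  let ?S = "base_inside rs (a, b)" and ?n = "sum_list rs"
  define T where "T = insert (a, b) ?S"
  define X Y where "X = fst ` T" and "Y = snd ` T"
  let ?p = "\<lambda>X. pick ((\<lambda>i. i - 1) ` X)"
  have S: "?S \<subseteq> base rs" "finite ?S"
    using finite_base[of rs] by (auto simp: base_inside_def intro: finite_subset)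
  have T: "T \<subseteq> roots_m rs" "finite T" unfolding T_def using S assms base_subset_roots_m[of rs] by auto
  have inj: "inj_on fst T" "inj_on snd T"
    using base_row_col_inj[of _ _ rs] by (fastforce simp: T_def inj_on_def base_inside_def)+
  have card: "card X = Suc (card ?S)" "card Y = Suc (card ?S)"
    unfolding X_def Y_def card_image[OF inj(1)] card_image[OF inj(2)]
    using S(2) by (auto simp: T_def base_inside_def)
  have "fst \<tau> \<in> {1..?n} \<and> snd \<tau> \<in> {1..?n}" if "\<tau> \<in> T" for \<tau>
    using subsetD[OF T(1) that] by (auto simp: roots_m_def pos_roots_def)
  then have XY: "X \<subseteq> {1..?n}" "Y \<subseteq> {1..?n}" unfolding X_def Y_def by blast+
  have pick: "bij_betw (\<lambda>i. Suc (?p Z i)) {..card ?S} Z" if "Z \<subseteq> {1..?n}" "card Z = Suc (card ?S)" for Z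
  proof -
    have fin: "finite Z" using that(1) finite_subset by blast
    have c: "card ((\<lambda>i. i - 1) ` Z) = Suc (card ?S)"
      using card_image[OF inj_on_pred[OF that(1)]] that(2) by simp
    have "inj_on (\<lambda>i. Suc (?p Z i)) {..card ?S}"
      using pick_mono_le[of _ "(\<lambda>i. i - 1) ` Z"] unfolding c
      by (intro linorder_inj_onI) (force simp: less_Suc_eq_le)+
    moreover have "(\<lambda>i. Suc (?p Z i)) ` {..card ?S} \<subseteq> Z"
    proof (intro image_subsetI)
      fix i assume "i \<in> {..card ?S}"
      then have "?p Z i \<in> (\<lambda>i. i - 1) ` Z" using pick_in_set_le[of i "(\<lambda>i. i - 1) ` Z"] c by simp
      then show "Suc (?p Z i) \<in> Z" using that(1) by (auto simp: subset_iff Suc_le_eq)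
    qed
    ultimately show ?thesis
      using fin that(2) by (intro bij_betw_imageI card_subset_eq) (simp_all add: card_image)
  qed
  define r c where "r = (\<lambda>i. Suc (?p X i))" and "c = (\<lambda>j. Suc (?p Y j))"
  have r: "inj_on r {..card ?S}" "r ` {..card ?S} = X" and c: "inj_on c {..card ?S}" "c ` {..card ?S} = Y"
    using pick[OF XY(1) card(1)] pick[OF XY(2) card(2)] by (simp_all add: bij_betw_def r_def c_def)
  have r0: "r 0 = a"
  proof -
    have "?p X 0 = (LEAST x. x \<in> (\<lambda>i. i - 1) ` X)" by simp
    also have "\<dots> = a - 1" by (rule Least_equality) (auto simp: X_def T_def base_inside_def)
    finally show ?thesis using XY(1) by (auto simp: r_def X_def T_def)
  qed
  let ?A = "mat (Suc (card ?S)) (Suc (card ?S)) (\<lambda>(i, j). gen_entry (roots_m rs) (r i, c j))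
    :: (nat \<times> nat, 'a) mpoly mat"
  have "(minorM rs (a, b) :: (nat \<times> nat, 'a) mpoly)
      = det (submatrix (gen_mat rs) ((\<lambda>i. i - 1) ` X) ((\<lambda>j. j - 1) ` Y))"
    by (simp add: minorM_def X_def Y_def T_def)
  also have "submatrix (gen_mat rs) ((\<lambda>i. i - 1) ` X) ((\<lambda>j. j - 1) ` Y) = ?A"
    using submatrix_gen_mat[OF XY] unfolding card by (simp add: r_def c_def)
  finally have A: "(minorM rs (a, b) :: (nat \<times> nat, 'a) mpoly) = det ?A" .
  have "(r 0, b) \<in> T" "fst ` T = r ` {..card ?S}" "snd ` T = c ` {..card ?S}"
    by (simp_all add: r0 r c) (simp_all add: T_def X_def Y_def)
  from det_matching_affine[OF r(1) c(1) T(1) inj this(2,3,1), where 'a = 'a]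
  obtain p q where pq: "p \<in> mp_over (roots_m rs \<inter> (r ` {1..card ?S} \<times> c ` {..card ?S}))"
    "q \<in> mp_over (roots_m rs \<inter> (r ` {..card ?S} \<times> c ` {..card ?S}) - {(r 0, b)})"
    "p \<noteq> 0" "det ?A = p * mp_var (r 0, b) + q"
    by blast
  have X: "X \<subseteq> {a..}" and Y: "Y \<subseteq> {..b}" by (auto simp: X_def Y_def T_def base_inside_def)
  have "r 0 \<notin> r ` {1..card ?S}" using inj_onD[OF r(1), of 0] by fastforce
  moreover have "r ` {1..card ?S} \<subseteq> X" unfolding r(2)[symmetric] by (rule image_mono) auto
  ultimately have "r ` {1..card ?S} \<subseteq> {a<..}" using X r0 by (force simp: order_less_le)
  then have "roots_m rs \<inter> (r ` {1..card ?S} \<times> c ` {..card ?S}) \<subseteq> roots_m rs \<inter> {(i, j). a < i \<and> j \<le> b}"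
    using Y c(2) by auto
  from mp_over_mono[OF this pq(1)]
  have "p \<in> mp_over (roots_m rs \<inter> {(i, j). a < i \<and> j \<le> b})" .
  moreover have "roots_m rs \<inter> (r ` {..card ?S} \<times> c ` {..card ?S}) - {(r 0, b)}
      \<subseteq> roots_m rs \<inter> {(i, j). a \<le> i \<and> j \<le> b} - {(a, b)}"
    unfolding r(2) c(2) r0 using X Y by auto
  from mp_over_mono[OF this pq(2)]
  have "q \<in> mp_over (roots_m rs \<inter> {(i, j). a \<le> i \<and> j \<le> b} - {(a, b)})" .
  moreover have "(minorM rs (a, b) :: (nat \<times> nat, 'a) mpoly) = p * mp_var (a, b) + q"
    using A pq(4) by (simp only: r0)
  ultimately show ?thesis using pq(3) by blast
qed

text \<open>
  Variables are ranked by column first and, within a column, from the bottom up.  The corner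
  of a minor (its top right entry) then has the largest rank among the entries of the minor.
\<close>
definition col_rank :: "root \<Rightarrow> int \<times> int" where
  "col_rank \<gamma> = (int (snd \<gamma>), - int (fst \<gamma>))"

lemma below_col_rank: "below col_rank (a, b) = {(i, j). j < b \<or> j = b \<and> a < i}"
  by (auto simp: below_def col_rank_def less_prod_def')

lemma inj_col_rank: "inj col_rank"
  by (auto simp: inj_on_def col_rank_def)

definition below_m :: "nat list \<Rightarrow> root \<Rightarrow> root set" where
  "below_m rs \<gamma> = roots_m rs \<inter> below col_rank \<gamma>"

lemma below_m_iff: "(i, j) \<in> below_m rs (a, b) \<longleftrightarrow> (i, j) \<in> roots_m rs \<and> (j < b \<or> j = b \<and> a < i)"
  by (simp add: below_m_def below_col_rank)

lemma below_m_trans: "\<gamma> \<in> below_m rs \<psi> \<Longrightarrow> insert \<gamma> (below_m rs \<gamma>) \<subseteq> below_m rs \<psi>"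
  by (auto simp: below_m_def below_def)

lemma minorM_in:
  assumes "(a, b) \<in> roots_m rs" "roots_m rs \<inter> {(i, j). a \<le> i \<and> j \<le> b} \<subseteq> V"
  shows "(minorM rs (a, b) :: (nat \<times> nat, 'a::idom) mpoly) \<in> mp_over V"
proof -
  obtain p q where pq: "p \<in> mp_over (roots_m rs \<inter> {(i, j). a < i \<and> j \<le> b})"
    "q \<in> mp_over (roots_m rs \<inter> {(i, j). a \<le> i \<and> j \<le> b} - {(a, b)})"
    "(minorM rs (a, b) :: (nat \<times> nat, 'a::idom) mpoly) = p * mp_var (a, b) + q"
    using minorM_affine[OF assms(1)] by blast
  show ?thesis unfolding pq(3)
  proof (intro mp_over_add mp_over_mult)
    show "p \<in> mp_over V" by (rule mp_over_mono[OF _ pq(1)]) (use assms(2) in auto)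
    show "q \<in> mp_over V" by (rule mp_over_mono[OF _ pq(2)]) (use assms(2) in auto)
    show "mp_var (a, b) \<in> mp_over V" by (rule mp_over_var) (use assms in auto)
  qed
qed

lemma minorM_nonzero:
  assumes "\<gamma> \<in> roots_m rs"
  shows "(minorM rs \<gamma> :: (nat \<times> nat, 'a::idom) mpoly) \<noteq> 0"
proof -
  obtain a b where ab: "\<gamma> = (a, b)" by (metis prod.exhaust)
  obtain p q where pq: "p \<in> mp_over (roots_m rs \<inter> {(i, j). a < i \<and> j \<le> b})"
    "q \<in> mp_over (roots_m rs \<inter> {(i, j). a \<le> i \<and> j \<le> b} - {(a, b)})" "p \<noteq> 0"
    "(minorM rs (a, b) :: (nat \<times> nat, 'a::idom) mpoly) = p * mp_var (a, b) + q"
    using minorM_affine[of a b rs] assms ab by blast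
  have "p \<in> mp_over (roots_m rs \<inter> {(i, j). a \<le> i \<and> j \<le> b} - {(a, b)})"
    by (rule mp_over_mono[OF _ pq(1)]) auto
  then show ?thesis unfolding ab pq(4) by (rule affine_mp_var_nonzero[OF _ pq(2) _ pq(3)]) simp
qed

lemma Phi_iff:
  "(j, l) \<in> Phi rs \<longleftrightarrow> (\<exists>i k. (i, j) \<in> base rs \<and> (k, l) \<in> base rs \<and> (j, k) \<in> roots_r rs)"
  by (auto simp: Phi_def admissible_def phi_of_def alpha_of_def image_iff)

lemma Phi_subset_roots_m: "Phi rs \<subseteq> roots_m rs"
proof
  fix \<phi> assume "\<phi> \<in> Phi rs"
  moreover obtain j l where jl: "\<phi> = (j, l)" by (metis prod.exhaust)
  ultimately obtain i k where "(k, l) \<in> base rs" "(j, k) \<in> roots_r rs" by (auto simp: Phi_iff)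
  then show "\<phi> \<in> roots_m rs"
    using roots_r_m_right[of j k rs j l] base_subset_roots_m[of rs]
    by (auto simp: jl roots_r_def pos_roots_def)
qed

text \<open>
  In the sum of \<open>minorM rs (i, x) * minorM rs (x, l)\<close> over \<open>j \<le> x \<le> k\<close>, the left factors stay in columns
  before \<open>l\<close>, and the right factors with \<open>x > j\<close> in rows below \<open>j\<close>.  So \<open>x\<^sub>j\<^sub>l\<close> comes only from the right
  factor for \<open>x = j\<close>, in which it is the corner variable.
\<close>
lemma polyL_affine:
  assumes "(j, l) \<in> Phi rs"
  shows "\<exists>p q. p \<in> mp_over (below_m rs (j, l)) \<and> q \<in> mp_over (below_m rs (j, l)) \<and> p \<noteq> 0 \<and>
    (polyL rs (j, l) :: (nat \<times> nat, 'a::idom) mpoly) = p * mp_var (j, l) + q"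
proof -
  let ?V = "below_m rs (j, l)" and ?M = "minorM rs :: root \<Rightarrow> (nat \<times> nat, 'a) mpoly"
  obtain i k where S: "(i, j) \<in> base rs" "(k, l) \<in> base rs" and jk: "(j, k) \<in> roots_r rs"
    using assms by (auto simp: Phi_iff)
  then have adm: "admissible rs ((i, j), (k, l))" by (simp add: admissible_def alpha_of_def)
  have m: "(i, j) \<in> roots_m rs" "(k, l) \<in> roots_m rs" using S base_subset_roots_m[of rs] by auto
  have lt: "j < k" "k < l" using jk m(2) by (auto simp: roots_r_def roots_m_def pos_roots_def)
  have left: "?M (i, x) \<in> mp_over ?V" if "j \<le> x" "x \<le> k" for x
    using roots_r_m_left[OF jk that m(1)] lt that
    by (intro minorM_in) (auto simp: below_m_iff)
  have right_root: "(x, l) \<in> roots_m rs" if "j \<le> x" "x \<le> k" for x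
    by (rule roots_r_m_right[OF jk that m(2)])
  have right: "?M (x, l) \<in> mp_over ?V" if "j < x" "x \<le> k" for x
    using right_root[of x] that by (intro minorM_in) (auto simp: below_m_iff)
  obtain p q where pq: "p \<in> mp_over (roots_m rs \<inter> {(x, y). j < x \<and> y \<le> l})"
    "q \<in> mp_over (roots_m rs \<inter> {(x, y). j \<le> x \<and> y \<le> l} - {(j, l)})" "p \<noteq> 0"
    "?M (j, l) = p * mp_var (j, l) + q"
    using minorM_affine[OF right_root[of j], where 'a = 'a] lt by auto
  have p: "p \<in> mp_over ?V" by (rule mp_over_mono[OF _ pq(1)]) (auto simp: below_m_iff)
  have q: "q \<in> mp_over ?V" by (rule mp_over_mono[OF _ pq(2)]) (auto simp: below_m_iff)
  let ?r = "\<Sum>x\<in>{j<..k}. ?M (i, x) * ?M (x, l)"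
  have "{j..k} = insert j {j<..k}" using lt by auto
  then have "polyL rs (j, l) = ?M (i, j) * ?M (j, l) + ?r"
    unfolding polyL_eq[OF adm] by simp
  then have "polyL rs (j, l) = (?M (i, j) * p) * mp_var (j, l) + (?M (i, j) * q + ?r)"
    unfolding pq(4) by (simp add: algebra_simps)
  moreover have "?M (i, j) * p \<in> mp_over ?V" using left[of j] lt p by (simp add: mp_over_mult)
  moreover have "?M (i, j) * q + ?r \<in> mp_over ?V"
    using left[of j] lt q by (intro mp_over_add mp_over_mult mp_over_sum left right) simp_all
  moreover have "?M (i, j) * p \<noteq> 0" using minorM_nonzero[OF m(1), where 'a = 'a] pq(3) by simp
  ultimately show ?thesis by blast
qed

text \<open>
  The multiplicative group of the subfield generated by the variables preceding \<open>\<psi>\<close>.  Each member of the two series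
  is shown to be \<open>L\<^sub>\<psi>\<close> times an element of this group.
\<close>
definition units_below :: "nat list \<Rightarrow> root \<Rightarrow> 'a::field ratfun set" where
  "units_below rs \<psi> = rat_over (below_m rs \<psi>) - {0}"

lemma units_below_mult: "x \<in> units_below rs \<psi> \<Longrightarrow> y \<in> units_below rs \<psi> \<Longrightarrow> x * y \<in> units_below rs \<psi>"
  and units_below_divide: "x \<in> units_below rs \<psi> \<Longrightarrow> y \<in> units_below rs \<psi> \<Longrightarrow> x / y \<in> units_below rs \<psi>"
  and units_below_1: "1 \<in> units_below rs \<psi>"
  by (auto simp: units_below_def rat_over_mult rat_over_divide)

lemma units_below_prod: "(\<And>x. x \<in> X \<Longrightarrow> f x \<in> units_below rs \<psi>) \<Longrightarrow> prod f X \<in> units_below rs \<psi>"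
  by (induction X rule: infinite_finite_induct) (auto intro: units_below_mult units_below_1)

lemma fM_units_below:
  assumes "\<gamma> \<in> below_m rs \<psi>"
  shows "(fM rs \<gamma> :: 'a::field ratfun) \<in> units_below rs \<psi>"
proof -
  obtain a b where ab: "\<gamma> = (a, b)" by (metis prod.exhaust)
  have m: "(a, b) \<in> roots_m rs" using assms by (simp add: ab below_m_def)
  have "roots_m rs \<inter> {(i, j). a \<le> i \<and> j \<le> b} \<subseteq> insert (a, b) (below_m rs (a, b))"
    by (auto simp: below_m_iff)
  then have "(minorM rs (a, b) :: (nat \<times> nat, 'a) mpoly) \<in> mp_over (below_m rs \<psi>)"
    using below_m_trans[OF assms] by (intro minorM_in[OF m]) (auto simp: ab)
  then show ?thesis
    using minorM_nonzero[OF m] by (simp add: units_below_def ab rat_over_to_fract)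
qed

lemma fL_units_below:
  assumes "\<phi> \<in> Phi rs" "\<phi> \<in> below_m rs \<psi>"
  shows "(fL rs \<phi> :: 'a::field ratfun) \<in> units_below rs \<psi>"
proof -
  obtain j l where jl: "\<phi> = (j, l)" by (metis prod.exhaust)
  obtain p q where pq: "p \<in> mp_over (below_m rs (j, l))" "q \<in> mp_over (below_m rs (j, l))" "p \<noteq> 0"
    "(polyL rs (j, l) :: (nat \<times> nat, 'a) mpoly) = p * mp_var (j, l) + q"
    using polyL_affine[of j l rs] assms(1) jl by blast
  have "(polyL rs (j, l) :: (nat \<times> nat, 'a) mpoly) \<noteq> 0"
    unfolding pq(4) by (rule affine_mp_var_nonzero[OF pq(1,2) _ pq(3)]) (simp add: below_m_iff)
  moreover have "below_m rs (j, l) \<subseteq> below_m rs \<psi>" "(j, l) \<in> below_m rs \<psi>"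
    using below_m_trans[OF assms(2)] by (auto simp: jl)
  then have "(polyL rs (j, l) :: (nat \<times> nat, 'a) mpoly) \<in> mp_over (below_m rs \<psi>)"
    unfolding pq(4)
    by (intro mp_over_add mp_over_mult mp_over_var mp_over_mono[OF _ pq(1)] mp_over_mono[OF _ pq(2)])
  ultimately show ?thesis by (simp add: units_below_def jl rat_over_to_fract)
qed

lemma fL_times_unit:
  fixes g :: "'a::field ratfun"
  assumes "\<psi> \<in> Phi rs" "g \<in> units_below rs \<psi>"
  shows "affine_in col_rank \<psi> (fL rs \<psi> * g)" "fL rs \<psi> * g \<in> ratfun_m rs"
proof -
  obtain j l where jl: "\<psi> = (j, l)" by (metis prod.exhaust)
  let ?V = "below_m rs (j, l)"
  obtain p q where pq: "p \<in> mp_over ?V" "q \<in> mp_over ?V" "p \<noteq> 0"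
    "(polyL rs (j, l) :: (nat \<times> nat, 'a) mpoly) = p * mp_var (j, l) + q"
    using polyL_affine[of j l rs] assms(1) jl by blast
  have g: "g \<in> rat_over ?V" "g \<noteq> 0" using assms(2) by (auto simp: units_below_def jl)
  have eq: "fL rs \<psi> * g = (to_fract p * g) * to_fract (mp_var (j, l)) + to_fract q * g"
    by (simp add: jl pq(4) algebra_simps)
  have mem: "to_fract p * g \<in> rat_over ?V" "to_fract q * g \<in> rat_over ?V"
    using pq(1,2) g(1) by (auto intro: rat_over_mult rat_over_to_fract)
  have sub: "?V \<subseteq> below col_rank (j, l)" "?V \<subseteq> roots_m rs" by (auto simp: below_m_def)
  show "affine_in col_rank \<psi> (fL rs \<psi> * g)"
    unfolding affine_in_def eq unfolding jl
    using rat_over_mono[OF sub(1) mem(1)] rat_over_mono[OF sub(1) mem(2)] pq(3) g(2)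
    by (intro bexI[of _ "to_fract p * g"] bexI[of _ "to_fract q * g"]) simp_all
  have "(j, l) \<in> roots_m rs" using assms(1) Phi_subset_roots_m by (auto simp: jl)
  then have "fL rs \<psi> * g \<in> rat_over (roots_m rs)"
    unfolding eq using rat_over_mono[OF sub(2) mem(1)] rat_over_mono[OF sub(2) mem(2)]
    by (intro rat_over_add rat_over_mult[of "to_fract p * g"] rat_over_to_fract mp_over_var)
  then show "fL rs \<psi> * g \<in> ratfun_m rs" by (simp add: rat_over_def ratfun_m_def)
qed

section \<open>The base in closed form\<close>

lemma bsum_0 [simp]: "bsum rs 0 = 0"
  by (simp add: bsum_def)

lemma bsum_rec: "t \<in> {1..length rs} \<Longrightarrow> bsum rs t = bsum rs (t - 1) + bsize rs t"
  by (cases t) (simp_all add: bsum_def bsize_def take_Suc_conv_app_nth)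

lemma in_block_less:
  assumes "in_block rs s a" "in_block rs t b" "s < t"
  shows "a < b"
proof -
  have "bsum rs s \<le> bsum rs (t - 1)" using assms(3) by (intro bsum_mono) simp
  then show ?thesis using assms(1,2) by (simp add: in_block_def)
qed

lemma ex_in_block:
  assumes "1 \<le> i" "i \<le> sum_list rs"
  obtains t where "in_block rs t i"
proof -
  define t where "t = (LEAST t. i \<le> bsum rs t)"
  have ex: "i \<le> bsum rs (length rs)" using assms(2) by (simp add: bsum_def)
  have 1: "i \<le> bsum rs t" unfolding t_def using ex by (rule LeastI)
  have 2: "t \<le> length rs" unfolding t_def using ex by (rule Least_le)
  have 3: "t \<noteq> 0" using 1 assms(1) by (intro notI) simp
  then have "\<not> i \<le> bsum rs (t - 1)" unfolding t_def by (intro not_less_Least) simp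
  then show thesis using 1 2 3 by (intro that[of t]) (simp add: in_block_def)
qed

lemma roots_m_iff:
  "(a, b) \<in> roots_m rs \<longleftrightarrow> (\<exists>s t. s < t \<and> in_block rs s a \<and> in_block rs t b)"
proof
  assume ab: "(a, b) \<in> roots_m rs"
  then have *: "1 \<le> a" "a < b" "b \<le> sum_list rs" by (auto simp: roots_m_def pos_roots_def)
  obtain s where s: "in_block rs s a" by (rule ex_in_block[of a rs]) (use * in auto)
  obtain t where t: "in_block rs t b" by (rule ex_in_block[of b rs]) (use * in auto)
  have "s \<noteq> t" using ab s t by (auto simp: roots_m_def roots_r_def)
  moreover have "\<not> t < s" using in_block_less[OF t s] * by auto
  ultimately have "s < t" by simp
  then show "\<exists>s t. s < t \<and> in_block rs s a \<and> in_block rs t b" using s t by blast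
next
  assume "\<exists>s t. s < t \<and> in_block rs s a \<and> in_block rs t b"
  then obtain s t where st: "s < t" "in_block rs s a" "in_block rs t b" by blast
  have "b \<le> bsum rs (length rs)"
    using st(3) bsum_mono[of t "length rs" rs] by (simp add: in_block_def)
  then have "(a, b) \<in> pos_roots rs"
    using in_block_less[OF st(2,3,1)] st(2) by (simp add: pos_roots_def in_block_def bsum_def)
  moreover have "(a, b) \<notin> roots_r rs"
  proof
    assume "(a, b) \<in> roots_r rs"
    then obtain u where "in_block rs u a" "in_block rs u b" by (auto simp: roots_r_def)
    then have "u = s" "u = t" using st(2,3) by (auto dest: in_block_inj)
    then show False using st(1) by simp
  qed
  ultimately show "(a, b) \<in> roots_m rs" by (simp add: roots_m_def)
qed

lemma roots_r_iff: "(a, b) \<in> roots_r rs \<longleftrightarrow> a < b \<and> (\<exists>t. in_block rs t a \<and> in_block rs t b)"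
proof -
  have "b \<le> sum_list rs" if "in_block rs t b" for t
    using that bsum_mono[of t "length rs" rs] by (simp add: in_block_def bsum_def)
  then show ?thesis by (auto simp: roots_r_def pos_roots_def in_block_def)
qed

text \<open>
  Rows of block \<open>s\<close> are counted from its bottom and columns of block \<open>t\<close> from its left end, because
  the base fills the blocks above the diagonal along antidiagonals that start at the bottom left corner.
\<close>
definition row_up :: "nat list \<Rightarrow> nat \<Rightarrow> nat \<Rightarrow> nat" where
  "row_up rs s m = bsum rs s + 1 - m"

definition col_right :: "nat list \<Rightarrow> nat \<Rightarrow> nat \<Rightarrow> nat" where
  "col_right rs t m = bsum rs (t - 1) + m"

lemma in_block_row_up:
  "in_block rs s a \<longleftrightarrow> s \<in> {1..length rs} \<and> (\<exists>m\<in>{1..bsize rs s}. a = row_up rs s m)"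
proof (cases "s \<in> {1..length rs}")
  case True
  note b = bsum_rec[OF True]
  show ?thesis
  proof
    assume "in_block rs s a"
    then show "s \<in> {1..length rs} \<and> (\<exists>m\<in>{1..bsize rs s}. a = row_up rs s m)"
      using True b by (intro conjI bexI[of _ "bsum rs s + 1 - a"]) (auto simp: in_block_def row_up_def)
  qed (use True b in \<open>auto simp: in_block_def row_up_def\<close>)
qed (auto simp: in_block_def)

lemma in_block_col_right:
  "in_block rs t b \<longleftrightarrow> t \<in> {1..length rs} \<and> (\<exists>m\<in>{1..bsize rs t}. b = col_right rs t m)"
proof (cases "t \<in> {1..length rs}")
  case True
  note b = bsum_rec[OF True]
  show ?thesis
  proof
    assume "in_block rs t b"
    then show "t \<in> {1..length rs} \<and> (\<exists>m\<in>{1..bsize rs t}. b = col_right rs t m)"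
      using True b by (intro conjI bexI[of _ "b - bsum rs (t - 1)"]) (auto simp: in_block_def col_right_def)
  qed (use True b in \<open>auto simp: in_block_def col_right_def\<close>)
qed (auto simp: in_block_def)

text \<open>
  Row \<open>m\<close> from the bottom of block \<open>s\<close> and column \<open>m\<close> from the left of block \<open>t\<close> carry a common root of
  the base when both blocks reach that far and every block strictly between has fewer than \<open>m\<close> rows.
\<close>
definition linked :: "nat list \<Rightarrow> nat \<Rightarrow> nat \<Rightarrow> nat \<Rightarrow> bool" where
  "linked rs s t m \<longleftrightarrow> 1 \<le> s \<and> s < t \<and> t \<le> length rs \<and> 1 \<le> m \<and> m \<le> bsize rs s \<and> m \<le> bsize rs t
     \<and> (\<forall>s'. s < s' \<and> s' < t \<longrightarrow> bsize rs s' < m)"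

lemma linked_in_block:
  assumes "linked rs s t m"
  shows "in_block rs s (row_up rs s m)" "in_block rs t (col_right rs t m)"
proof -
  show "in_block rs s (row_up rs s m)" using assms by (auto simp: in_block_row_up linked_def)
  show "in_block rs t (col_right rs t m)" using assms by (auto simp: in_block_col_right linked_def)
qed

lemma linked_unique:
  "linked rs s t m \<Longrightarrow> linked rs s t' m \<Longrightarrow> t = t'"
  "linked rs s t m \<Longrightarrow> linked rs s' t m \<Longrightarrow> s = s'"
  unfolding linked_def by (meson linorder_neqE_nat not_less)+

lemma row_up_inj:
  assumes "row_up rs s m = row_up rs s m'" "m \<le> bsize rs s" "m' \<le> bsize rs s" "s \<in> {1..length rs}"
  shows "m = m'"
  using assms bsum_rec[OF assms(4)] by (simp add: row_up_def)

lemma ex_linked_row: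
  assumes "1 \<le> s" "s < t" "t \<le> length rs" "1 \<le> m" "m \<le> bsize rs s" "m \<le> bsize rs t"
  obtains t' where "t' \<le> t" "linked rs s t' m"
proof -
  let ?P = "\<lambda>t'. s < t' \<and> m \<le> bsize rs t'"
  define t' where "t' = (LEAST t'. ?P t')"
  have P: "?P t" using assms by simp
  have "?P t'" unfolding t'_def by (rule LeastI[of ?P, OF P])
  moreover have "t' \<le> t" unfolding t'_def by (rule Least_le[of ?P, OF P])
  moreover have "bsize rs s' < m" if "s < s'" "s' < t'" for s'
    using not_less_Least[of s' ?P] that by (auto simp: t'_def)
  ultimately show thesis using assms by (intro that[of t']) (auto simp: linked_def)
qed

lemma ex_linked_col:
  assumes "1 \<le> s" "s < t" "t \<le> length rs" "1 \<le> m" "m \<le> bsize rs s" "m \<le> bsize rs t"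
  obtains s' where "s \<le> s'" "linked rs s' t m"
proof -
  let ?P = "\<lambda>s'. s' < t \<and> m \<le> bsize rs s'"
  define s' where "s' = (GREATEST s'. ?P s')"
  have P: "?P s" using assms by simp
  have bd: "\<And>y. ?P y \<Longrightarrow> y \<le> t" by simp
  have "?P s'" unfolding s'_def by (rule GreatestI_nat[of ?P, OF P bd])
  moreover have "s \<le> s'" unfolding s'_def by (rule Greatest_le_nat[of ?P, OF P bd])
  moreover have "bsize rs x < m" if "s' < x" "x < t" for x
    using Greatest_le_nat[of ?P x t] bd that unfolding s'_def[symmetric] by force
  ultimately show thesis using assms by (intro that[of s']) (auto simp: linked_def)
qed

lemma is_base_unique: "is_base rs S \<Longrightarrow> is_base rs S' \<Longrightarrow> S = S'"
  using ex1_is_base[of rs] by metis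

text \<open>
  The base as a stack: the columns of a block take the nearest rows above that are still free, from the
  bottom up, and the block then pushes its own rows.  A row at height \<open>m\<close> of its block thus stays at
  height \<open>m\<close> until the next block with at least \<open>m\<close> columns, where it meets column \<open>m\<close>.  The proof
  verifies the characterisation of the base.  Two linked roots in a common row or column coincide.
  For a root in row \<open>m\<close> of block \<open>s\<close> and column \<open>l\<close> of block \<open>t\<close>, the linked root in its row (if \<open>m \<le> l\<close>)
  or in its column (if \<open>l < m\<close>) either lies strictly closer to the diagonal or is the given root.
\<close>
lemma base_eq: "base rs = {(row_up rs s m, col_right rs t m) |s t m. linked rs s t m}"
proof -
  let ?E = "{(row_up rs s m, col_right rs t m) |s t m. linked rs s t m}"
  have sub: "?E \<subseteq> roots_m rs"
  proof
    fix \<gamma> assume "\<gamma> \<in> ?E"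
    then obtain s t m where *: "\<gamma> = (row_up rs s m, col_right rs t m)" "linked rs s t m" by blast
    then have "s < t" by (simp add: linked_def)
    then show "\<gamma> \<in> roots_m rs"
      using linked_in_block[OF *(2)] unfolding *(1) roots_m_iff by blast
  qed
  have row: "b = d" if "(a, b) \<in> ?E" "(a, d) \<in> ?E" for a b d
  proof -
    obtain s t m where 1: "a = row_up rs s m" "b = col_right rs t m" "linked rs s t m"
      using \<open>(a, b) \<in> ?E\<close> by blast
    obtain s' t' m' where 2: "a = row_up rs s' m'" "d = col_right rs t' m'" "linked rs s' t' m'"
      using \<open>(a, d) \<in> ?E\<close> by blast
    have s: "s = s'" using in_block_inj linked_in_block(1)[OF 1(3)] linked_in_block(1)[OF 2(3)] 1(1) 2(1)
      by metis
    have "m = m'" by (rule row_up_inj[of rs s]) (use 1 2 s in \<open>auto simp: linked_def\<close>)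
    then show ?thesis using s 1 2 linked_unique(1)[of rs s t m t'] by simp
  qed
  have col: "a = c" if "(a, b) \<in> ?E" "(c, b) \<in> ?E" for a b c
  proof -
    obtain s t m where 1: "a = row_up rs s m" "b = col_right rs t m" "linked rs s t m"
      using \<open>(a, b) \<in> ?E\<close> by blast
    obtain s' t' m' where 2: "c = row_up rs s' m'" "b = col_right rs t' m'" "linked rs s' t' m'"
      using \<open>(c, b) \<in> ?E\<close> by blast
    have t: "t = t'" using in_block_inj linked_in_block(2)[OF 1(3)] linked_in_block(2)[OF 2(3)] 1(2) 2(2)
      by metis
    have "m = m'" using 1(2) 2(2) t by (simp add: col_right_def)
    then show ?thesis using t 1 2 linked_unique(2)[of rs s t m s'] by simp
  qed
  have incomparable: "\<not> root_gt rs \<gamma> \<gamma>'" if "\<gamma> \<in> ?E" "\<gamma>' \<in> ?E" for \<gamma> \<gamma>'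
  proof -
    obtain a b c d where eq: "\<gamma> = (a, b)" "\<gamma>' = (c, d)" by (metis prod.exhaust)
    have "(a, b) \<in> pos_roots rs" "(c, d) \<in> pos_roots rs"
      using roots_m_pos[OF subsetD[OF sub that(1)]] roots_m_pos[OF subsetD[OF sub that(2)]]
      unfolding eq by simp_all
    moreover have "b = d" if "a = c" using row[of a b d] \<open>\<gamma> \<in> ?E\<close> \<open>\<gamma>' \<in> ?E\<close> that unfolding eq by blast
    moreover have "a = c" if "b = d" using col[of a b c] \<open>\<gamma> \<in> ?E\<close> \<open>\<gamma>' \<in> ?E\<close> that unfolding eq by blast
    ultimately show ?thesis unfolding eq by (auto simp: root_gt_iff)
  qed
  have cover: "\<exists>\<xi>\<in>?E. root_gt rs \<gamma> \<xi>" if \<gamma>: "\<gamma> \<in> roots_m rs" "\<gamma> \<notin> ?E" for \<gamma>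
  proof -
    obtain a b where ab: "\<gamma> = (a, b)" by (metis prod.exhaust)
    obtain s t where st: "s < t" "in_block rs s a" "in_block rs t b"
      using \<gamma>(1) unfolding ab roots_m_iff by blast
    obtain m where m: "m \<in> {1..bsize rs s}" "a = row_up rs s m"
      using st(2) unfolding in_block_row_up by blast
    obtain l where l: "l \<in> {1..bsize rs t}" "b = col_right rs t l"
      using st(3) unfolding in_block_col_right by blast
    have len: "1 \<le> s" "t \<le> length rs" using st(2,3) by (auto simp: in_block_def)
    have pos: "(a, b) \<in> pos_roots rs" using \<gamma>(1) by (simp add: ab roots_m_pos)
    have gt: ?thesis if "(c, d) \<in> ?E" "(a = c \<and> d < b) \<or> (b = d \<and> a < c)" for c d
    proof -
      have "(c, d) \<in> pos_roots rs" using subsetD[OF sub that(1)] by (rule roots_m_pos)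
      then have "root_gt rs \<gamma> (c, d)" using that(2) pos by (simp only: ab root_gt_iff)
      then show ?thesis using that(1) by blast
    qed
    show ?thesis
    proof (cases "m \<le> l")
      case True
      obtain t' where t': "t' \<le> t" "linked rs s t' m"
        by (rule ex_linked_row[of s t rs m]) (use st len m l True in auto)
      have E: "(a, col_right rs t' m) \<in> ?E" using t'(2) m(2) by blast
      have "col_right rs t' m \<noteq> b" using E \<gamma>(2) ab by auto
      moreover have "col_right rs t' m \<le> b"
        using True bsum_mono[OF diff_le_mono[OF t'(1), of 1], of rs] by (simp add: l(2) col_right_def)
      ultimately show ?thesis using gt[OF E] by simp
    next
      case False
      obtain s' where s': "s \<le> s'" "linked rs s' t l"
        by (rule ex_linked_col[of s t rs l]) (use st len m l False in auto)
      have E: "(row_up rs s' l, b) \<in> ?E" using s'(2) l(2) by blast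
      have "row_up rs s' l > a"
        using False bsum_mono[OF s'(1), of rs] bsum_rec[of s rs] m len st(1)
        by (simp add: m(2) row_up_def)
      then show ?thesis using gt[OF E] by simp
    qed
  qed
  have "is_base rs ?E"
    unfolding is_base_def root_comparable_def
  proof (intro conjI ballI impI)
    show "?E \<subseteq> roots_m rs" by (rule sub)
    show "\<not> (root_gt rs \<gamma>' \<gamma> \<or> root_gt rs \<gamma> \<gamma>')" if "\<gamma> \<in> ?E" "\<gamma>' \<in> ?E" for \<gamma> \<gamma>'
      using incomparable[OF that] incomparable[OF that(2,1)] by simp
    show "\<exists>\<xi>\<in>?E. root_gt rs \<gamma> \<xi>" if "\<gamma> \<in> roots_m rs - ?E" for \<gamma>
      using that by (intro cover) simp_all
  qed
  then show ?thesis by (rule is_base_unique[OF is_base_base])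
qed

lemma base_linked: "linked rs s t m \<Longrightarrow> (row_up rs s m, col_right rs t m) \<in> base rs"
  unfolding base_eq by blast

section \<open>The first series of rational functions\<close>

text \<open>
  Neither of the two corners in column \<open>a\<close> can lie in the base.  For \<open>(i, a)\<close> this would put a second
  root of the base in column \<open>a\<close>.  If \<open>(j, a)\<close> were in the base, the root of the base in
  column \<open>b\<close> would lie in a row \<open>k > j\<close> of the same block; then \<open>(k, a)\<close> would be a root of the nilradical not above any root of
  the base, since row \<open>k\<close> meets the base only in column \<open>b > a\<close> and column \<open>a\<close> only in row \<open>j < k\<close>.
\<close>
lemma rectangle_in_Phi:
  assumes \<psi>: "(i, b) \<in> Phi rs" and "i < j" "a < b"
    and "(i, a) \<in> base rs \<union> Phi rs" "(j, a) \<in> base rs \<union> Phi rs" "(j, b) \<in> base rs \<union> Phi rs"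
  shows "(i, a) \<in> Phi rs" "(j, a) \<in> Phi rs"
proof -
  obtain k where k: "(k, b) \<in> base rs" "(i, k) \<in> roots_r rs" using \<psi> by (auto simp: Phi_iff)
  have "(i, a) \<notin> base rs"
  proof
    assume ia: "(i, a) \<in> base rs"
    then have "(j, a) \<notin> base rs" using base_row_col_inj[of i a rs j a] \<open>i < j\<close> by auto
    then obtain k' where k': "(k', a) \<in> base rs" "(j, k') \<in> roots_r rs"
      using assms(5) by (auto simp: Phi_iff)
    then have "i = k'" using base_row_col_inj[OF ia k'(1)] by simp
    then show False using k'(2) \<open>i < j\<close> by (simp add: roots_r_iff)
  qed
  then show ia: "(i, a) \<in> Phi rs" using assms(4) by simp
  have "(j, a) \<notin> base rs"
  proof
    assume ja: "(j, a) \<in> base rs"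
    then have "(j, b) \<notin> base rs" using base_row_col_inj[of j a rs j b] \<open>a < b\<close> by auto
    then obtain k' where k': "(k', b) \<in> base rs" "(j, k') \<in> roots_r rs"
      using assms(6) by (auto simp: Phi_iff)
    then have jk: "(j, k) \<in> roots_r rs" using base_row_col_inj[OF k(1) k'(1)] by simp
    then have "j < k" by (simp add: roots_r_iff)
    have "(j, a) \<in> roots_m rs" using ja base_subset_roots_m by blast
    then obtain s t where st: "s < t" "in_block rs s j" "in_block rs t a" by (auto simp: roots_m_iff)
    obtain u where u: "in_block rs u j" "in_block rs u k" using jk by (auto simp: roots_r_iff)
    have "u = s" by (rule in_block_inj[OF u(1) st(2)])
    then have m: "(k, a) \<in> roots_m rs" using st u(2) unfolding roots_m_iff by blast
    have "(k, a) \<notin> base rs" using base_row_col_inj[of k a rs k b] k(1) \<open>a < b\<close> by auto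
    with m have "(k, a) \<in> roots_m rs - base rs" by simp
    moreover have "\<forall>\<gamma>\<in>roots_m rs - base rs. \<exists>\<xi>\<in>base rs. root_gt rs \<gamma> \<xi>"
      using is_base_base[of rs] by (simp add: is_base_def)
    ultimately have "\<exists>\<xi>\<in>base rs. root_gt rs (k, a) \<xi>" by (rule bspec[rotated])
    then obtain c d where cd: "(c, d) \<in> base rs" "root_gt rs (k, a) (c, d)" by (metis prod.exhaust)
    have "(c, d) \<in> roots_m rs" using cd(1) base_subset_roots_m by blast
    then have "(k = c \<and> d < a) \<or> (a = d \<and> k < c)"
      using cd(2) root_gt_iff[of k a rs c d] m by (simp add: roots_m_pos)
    then show False
      using base_row_col_inj[OF cd(1) k(1)] base_row_col_inj[OF cd(1) ja] \<open>a < b\<close> \<open>j < k\<close> by auto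
  qed
  then show "(j, a) \<in> Phi rs" using assms(5) by simp
qed

text \<open>
  The other three corners of the rectangle lie to the left of \<open>\<psi>\<close> or below it, and the extra minor in the denominator
  has its corner in column \<open>j < a\<close>.
\<close>
lemma A_fun_factor:
  assumes "\<psi> \<in> Phi rs" "is_rectangle rs \<psi> w"
  shows "\<exists>g\<in>units_below rs \<psi>. (A_fun rs w \<psi> :: 'a::field ratfun) = fL rs \<psi> * g"
proof -
  obtain i j a b where eq: "\<psi> = (i, b)" "w = ((i, a), (j, a), (j, b))" and ij: "i < j" and ab: "a < b"
    and sub: "(i, a) \<in> base rs \<union> Phi rs" "(j, a) \<in> base rs \<union> Phi rs" "(j, b) \<in> base rs \<union> Phi rs"
    using assms(2) unfolding is_rectangle_def by blast
  note Phi = rectangle_in_Phi[OF assms(1)[unfolded eq] ij ab sub]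
  have m: "\<gamma> \<in> roots_m rs" if "\<gamma> \<in> base rs \<union> Phi rs" for \<gamma>
    using that base_subset_roots_m[of rs] Phi_subset_roots_m[of rs] by blast
  have 1: "fL rs (i, a) \<in> (units_below rs \<psi> :: 'a ratfun set)"
    and 2: "fL rs (j, a) \<in> (units_below rs \<psi> :: 'a ratfun set)"
    using m[OF sub(1)] m[OF sub(2)] ab Phi by (auto intro!: fL_units_below simp: eq below_m_iff)
  have jb: "(j, b) \<in> below_m rs \<psi>" using m[OF sub(3)] ij by (simp add: eq below_m_iff)
  show ?thesis
  proof (cases "(j, b) \<in> Phi rs")
    case True
    have "fL rs (j, a) / (fL rs (i, a) * fL rs (j, b)) \<in> (units_below rs \<psi> :: 'a ratfun set)"
      by (intro units_below_divide units_below_mult 1 2 fL_units_below True jb)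
    then show ?thesis by (rule bexI[rotated]) (simp add: A_fun_def eq True)
  next
    case False
    obtain i' k' where ik: "(i', j) \<in> base rs" "(k', a) \<in> base rs" "(j, k') \<in> roots_r rs"
      using Phi(2) by (auto simp: Phi_iff)
    have adm: "admissible rs ((i', j), (k', a))" using ik by (simp add: admissible_def alpha_of_def)
    have pair: "pair_of rs (j, a) = ((i', j), (k', a))"
      using pair_of_phi[OF adm] by (simp add: phi_of_def)
    have "(j, a) \<in> roots_m rs" using m[OF sub(2)] .
    then have "j < a" by (simp add: roots_m_def pos_roots_def)
    then have ij': "(i', j) \<in> below_m rs \<psi>" using ik(1) m ab by (simp add: eq below_m_iff)
    have "fL rs (j, a) / (fL rs (i, a) * fM rs (i', j) * fM rs (j, b)) \<in> (units_below rs \<psi> :: 'a ratfun set)"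
      by (intro units_below_divide units_below_mult 1 2 fM_units_below ij' jb)
    then show ?thesis by (rule bexI[rotated]) (simp add: A_fun_def eq False pair)
  qed
qed

section \<open>The second series of rational functions\<close>

lemma nth_sorted_list_of_set_le:
  fixes X :: "nat set"
  assumes "finite X" "C \<subseteq> X" "C \<subseteq> {..N}" "card C = k" "1 \<le> k"
  shows "sorted_list_of_set X ! (k - 1) \<in> X" "sorted_list_of_set X ! (k - 1) \<le> N"
proof -
  let ?xs = "sorted_list_of_set X"
  have len: "k - 1 < length ?xs" using card_mono[OF assms(1,2)] assms(4,5) by simp
  show "?xs ! (k - 1) \<in> X" using nth_mem[OF len] assms(1) by simp
  show "?xs ! (k - 1) \<le> N"
  proof (rule ccontr)
    assume gt: "\<not> ?xs ! (k - 1) \<le> N"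
    have "C \<subseteq> set (take (k - 1) ?xs)"
    proof
      fix c assume "c \<in> C"
      then have "c \<in> set ?xs" "c \<le> N" using assms(1-3) by auto
      then obtain n where n: "n < length ?xs" "?xs ! n = c" by (meson in_set_conv_nth)
      have "n < k - 1"
      proof (rule ccontr)
        assume "\<not> n < k - 1"
        then have "?xs ! (k - 1) \<le> ?xs ! n" using n(1) by (intro sorted_nth_mono) auto
        then show False using gt n(2) \<open>c \<le> N\<close> by simp
      qed
      then show "c \<in> set (take (k - 1) ?xs)" using n by (auto simp: in_set_conv_nth)
    qed
    then have "card C \<le> card (set (take (k - 1) ?xs))" by (intro card_mono) auto
    also have "\<dots> \<le> k - 1" using card_length[of "take (k - 1) ?xs"] by simp
    finally show False using assms(4,5) by simp
  qed
qed

lemma finite_Phi: "finite (Phi rs)"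
  using Phi_subset_roots_m finite_roots_m by (rule finite_subset)

lemma finite_Phi_cols: "finite (Phi_cols rs i)"
  by (rule finite_subset[OF _ finite_imageI[OF finite_Phi[of rs], of snd]])
    (force simp: Phi_cols_def)

locale positive_blocks =
  fixes rs :: "nat list"
  assumes pos: "\<forall>r\<in>set rs. r > 0"
begin

lemma bsize_pos: "t \<in> {1..length rs} \<Longrightarrow> 1 \<le> bsize rs t"
  using pos nth_mem[of "t - 1" rs] by (auto simp: bsize_def Suc_le_eq)

lemma corner_in_base:
  assumes "1 \<le> t" "t < length rs"
  shows "(bsum rs t, bsum rs t + 1) \<in> base rs"
proof -
  have "linked rs t (Suc t) 1"
    using assms bsize_pos[of t] bsize_pos[of "Suc t"] by (auto simp: linked_def)
  from base_linked[OF this] show ?thesis by (simp add: row_up_def col_right_def)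
qed

lemma in_block_first: "s \<in> {1..length rs} \<Longrightarrow> in_block rs s (bsum rs (s - 1) + 1)"
  using bsum_rec[of s rs] bsize_pos[of s] by (auto simp: in_block_def)

lemma in_block_last: "s \<in> {1..length rs} \<Longrightarrow> in_block rs s (bsum rs s)"
  using bsum_rec[of s rs] bsize_pos[of s] by (auto simp: in_block_def)

text \<open>
  Each root of \<open>Phi\<close> in the first row of a block uses the base root of its column, and these lie in
  different lower rows of the block.
\<close>
lemma card_Phi_cols_first:
  assumes "s \<in> {1..length rs}"
  shows "card (Phi_cols rs (bsum rs (s - 1) + 1)) \<le> bsize rs s - 1"
proof -
  let ?f = "bsum rs (s - 1) + 1"
  let ?X = "{\<xi> \<in> base rs. fst \<xi> \<in> {?f<..bsum rs s}}"
  have X: "finite ?X" using finite_base by simp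
  have "Phi_cols rs ?f \<subseteq> snd ` ?X"
  proof
    fix l assume "l \<in> Phi_cols rs ?f"
    then obtain k where k: "(k, l) \<in> base rs" "(?f, k) \<in> roots_r rs"
      by (auto simp: Phi_cols_def Phi_iff)
    then obtain u where u: "in_block rs u ?f" "in_block rs u k" "?f < k" by (auto simp: roots_r_iff)
    then have "u = s" using in_block_inj in_block_first[OF assms] by metis
    then have "(k, l) \<in> ?X" using k(1) u by (simp add: in_block_def)
    then show "l \<in> snd ` ?X" by force
  qed
  then have "card (Phi_cols rs ?f) \<le> card (snd ` ?X)" using X by (intro card_mono) auto
  also have "\<dots> \<le> card ?X" using X by (rule card_image_le)
  also have "\<dots> = card (fst ` ?X)"
    by (intro card_image[symmetric] inj_onI) (auto dest: base_row_col_inj)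
  also have "\<dots> \<le> card {?f<..bsum rs s}" by (intro card_mono) auto
  also have "\<dots> = bsize rs s - 1" using bsum_rec[OF assms] by simp
  finally show ?thesis .
qed

text \<open>
  The base roots in the lowest \<open>k\<close> rows of block \<open>s\<close> occur no later than in block \<open>t\<close>, which has enough
  columns.  None of these rows is the first one of the block, so each contributes a root of \<open>Phi\<close> to the first row.
  This bounds the number of these roots and locates the first \<open>k\<close> of them.
\<close>
lemma Phi_cols_first_lower:
  assumes "2 \<le> s" "s < t" "t \<le> length rs" "k < bsize rs s" "k < bsize rs t"
  obtains C where "C \<subseteq> Phi_cols rs (bsum rs (s - 1) + 1)" "C \<subseteq> {..bsum rs t}" "card C = k"
proof -
  let ?f = "bsum rs (s - 1) + 1"
  have s: "s \<in> {1..length rs}" using assms by simp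
  have corner: "(bsum rs (s - 1), ?f) \<in> base rs" using assms by (intro corner_in_base) auto
  have "\<exists>l. (row_up rs s m, l) \<in> base rs \<and> l \<le> bsum rs t" if m: "m \<in> {1..k}" for m
  proof -
    obtain t' where t': "t' \<le> t" "linked rs s t' m"
      by (rule ex_linked_row[of s t rs m]) (use assms m in auto)
    have "col_right rs t' m \<le> bsum rs t'"
      using linked_in_block(2)[OF t'(2)] by (simp add: in_block_def)
    also have "\<dots> \<le> bsum rs t" by (rule bsum_mono[OF t'(1)])
    finally show ?thesis using base_linked[OF t'(2)] by blast
  qed
  then obtain g where g: "\<And>m. m \<in> {1..k} \<Longrightarrow> (row_up rs s m, g m) \<in> base rs"
    "\<And>m. m \<in> {1..k} \<Longrightarrow> g m \<le> bsum rs t"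
    by metis
  show thesis
  proof (rule that)
    show "g ` {1..k} \<subseteq> Phi_cols rs ?f"
    proof
      fix l assume "l \<in> g ` {1..k}"
      then obtain m where m: "m \<in> {1..k}" "l = g m" by blast
      have "in_block rs s (row_up rs s m)" using m(1) s assms(4) by (auto simp: in_block_row_up)
      moreover have "?f < row_up rs s m" using m(1) assms(4) bsum_rec[OF s] by (auto simp: row_up_def)
      ultimately have "(?f, row_up rs s m) \<in> roots_r rs"
        using in_block_first[OF s] by (auto simp: roots_r_iff)
      then show "l \<in> Phi_cols rs ?f" using g(1)[OF m(1)] corner m(2) by (auto simp: Phi_cols_def Phi_iff)
    qed
    show "g ` {1..k} \<subseteq> {..bsum rs t}" using g(2) by auto
    have "inj_on g {1..k}"
    proof (rule inj_onI)
      fix m m' assume m: "m \<in> {1..k}" "m' \<in> {1..k}" "g m = g m'"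
      then have "row_up rs s m = row_up rs s m'"
        using base_row_col_inj[OF g(1)[OF m(1)] g(1)[OF m(2)]] by blast
      moreover have "m \<le> bsize rs s" "m' \<le> bsize rs s" using m(1,2) assms(4) by simp_all
      ultimately show "m = m'" using s by (rule row_up_inj)
    qed
    then show "card (g ` {1..k}) = k" by (simp add: card_image)
  qed
qed

lemma psi2_form_unique:
  assumes "psi2_form rs \<psi> (t, k)" "psi2_form rs \<psi> (t', k')"
  shows "t = t' \<and> k = k'"
proof -
  have "in_block rs t (fst \<psi>)" "in_block rs t' (fst \<psi>)"
    using assms bsum_rec[of t rs] bsum_rec[of t' rs] by (auto simp: psi2_form_def in_block_def)
  then have "t = t'" by (rule in_block_inj)
  then show ?thesis using assms by (simp add: psi2_form_def)
qed

text \<open>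
  The numerical content of membership in \<open>Psi2\<close>: both blocks have more than \<open>k\<close> rows, block \<open>s\<close> is not the first
  one (its first column carries a root of the base), and maximality of \<open>s\<close> forces the blocks strictly
  between to have at most \<open>k\<close> rows.  Hence, for every \<open>m > k\<close> not exceeding the two block sizes, the blocks \<open>s\<close>
  and \<open>t\<close> are linked at height \<open>m\<close>.
\<close>
lemma Psi2_blocks:
  assumes "\<psi> \<in> Psi2 rs"
  obtains s t k where "psi2_form rs \<psi> (t, k)" "s = Max (s_candidates rs (t, k))"
    "2 \<le> s" "s < t" "t < length rs" "1 \<le> k" "k < bsize rs s" "k < bsize rs t"
    "\<And>s'. s < s' \<Longrightarrow> s' < t \<Longrightarrow> bsize rs s' \<le> k"
proof -
  obtain t k where p: "psi2_form rs \<psi> (t, k)" and ne: "s_candidates rs (t, k) \<noteq> {}"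
    and Phi: "\<psi> \<in> Phi rs"
    using assms by (auto simp: Psi2_def)
  have tk: "t \<in> {1..length rs}" "1 \<le> k" "k < bsize rs t" "\<psi> = (bsum rs (t - 1) + k, bsum rs t + 1)"
    using p by (auto simp: psi2_form_def)
  have "bsum rs t + 1 \<le> sum_list rs"
    using Phi Phi_subset_roots_m[of rs] tk(4) by (auto simp: roots_m_def pos_roots_def)
  then have "t \<noteq> length rs" by (auto simp: bsum_def)
  then have t: "t < length rs" using tk(1) by simp
  define s where "s = Max (s_candidates rs (t, k))"
  have fin: "finite (s_candidates rs (t, k))"
    by (rule finite_subset[of _ "{..t}"]) (auto simp: s_candidates_def)
  have "s \<in> s_candidates rs (t, k)" unfolding s_def by (rule Max_in[OF fin ne])
  then have s: "1 \<le> s" "s < t" "k \<le> card (Phi_cols rs (bsum rs (s - 1) + 1))"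
    by (auto simp: s_candidates_def)
  have s_in: "s \<in> {1..length rs}" using s t by simp
  have ks: "k < bsize rs s" using card_Phi_cols_first[OF s_in] s(3) bsize_pos[OF s_in] by simp
  have "Phi_cols rs (bsum rs (s - 1) + 1) \<noteq> {}" using s(3) tk(2) by (metis card.empty not_one_le_zero le_trans)
  then obtain i where "(i, bsum rs (s - 1) + 1) \<in> base rs" by (auto simp: Phi_cols_def Phi_iff)
  then have "(i, bsum rs (s - 1) + 1) \<in> roots_m rs" using base_subset_roots_m by blast
  then obtain u v where "u < v" "in_block rs u i" "in_block rs v (bsum rs (s - 1) + 1)"
    by (auto simp: roots_m_iff)
  moreover from this have "v = s" using in_block_inj in_block_first[OF s_in] by metis
  ultimately have s2: "2 \<le> s" by (auto simp: in_block_def)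
  have "bsize rs s' \<le> k" if s': "s < s'" "s' < t" for s'
  proof (rule ccontr)
    assume "\<not> bsize rs s' \<le> k"
    then have "k < bsize rs s'" by simp
    then obtain C where C: "C \<subseteq> Phi_cols rs (bsum rs (s' - 1) + 1)" "card C = k"
      using Phi_cols_first_lower[of s' t k] s' s2 t tk(3) by (metis le_trans less_imp_le)
    then have "k \<le> card (Phi_cols rs (bsum rs (s' - 1) + 1))"
      using card_mono[OF finite_Phi_cols C(1)] by simp
    then have "s' \<in> s_candidates rs (t, k)" using s' s(1) by (simp add: s_candidates_def)
    then have "s' \<le> s" unfolding s_def by (rule Max_ge[OF fin])
    then show False using s'(1) by simp
  qed
  then show thesis using that[OF p s_def s2 s(2) t tk(2) ks tk(3)] by blast
qed

text \<open>
  Since \<open>s\<close> and \<open>t\<close> are linked at every height above \<open>k\<close> that both block sizes allow, the roots \<open>\<gamma>\<^sub>4\<close> and \<open>\<gamma>\<^sub>5\<close> can be written down, and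
  they end in columns of block \<open>t\<close> at the latest.  Apart from \<open>L\<^sub>\<psi>\<close>, the only factors reaching the column \<open>bsum rs t + 1\<close> of \<open>\<psi>\<close> are \<open>M\<close> at
  \<open>\<gamma>\<^sub>3\<close> and, when block \<open>s\<close> is the smaller one, \<open>L\<close> at \<open>\<xi>\<^sub>2\<close>; their corners lie in rows below that of \<open>\<psi>\<close>.
  For \<open>\<xi>\<^sub>2\<close> this is the inequality \<open>k < bsize rs s\<close>.
\<close>
lemma B_fun_factor:
  assumes "\<psi> \<in> Psi2 rs"
  shows "\<exists>g\<in>units_below rs \<psi>. (B_fun rs \<psi> :: 'a::field ratfun) = fL rs \<psi> * g"
proof -
  obtain s t k where p: "psi2_form rs \<psi> (t, k)" and s_def: "s = Max (s_candidates rs (t, k))"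
    and s2: "2 \<le> s" and st: "s < t" and t: "t < length rs" and k1: "1 \<le> k"
    and ks: "k < bsize rs s" and kt: "k < bsize rs t"
    and mid: "\<And>s'. s < s' \<Longrightarrow> s' < t \<Longrightarrow> bsize rs s' \<le> k"
    using Psi2_blocks[OF assms] by metis
  let ?U = "units_below rs \<psi> :: 'a ratfun set"
  let ?f = "bsum rs (s - 1) + 1"
  have \<psi>: "\<psi> = (bsum rs (t - 1) + k, bsum rs t + 1)" using p by (simp add: psi2_form_def)
  have blocks: "s \<in> {1..length rs}" "t \<in> {1..length rs}" using s2 st t by auto
  note sb = bsum_rec[OF blocks(1)] and tb = bsum_rec[OF blocks(2)]
  have link: "linked rs s t m" if "k < m" "m \<le> bsize rs s" "m \<le> bsize rs t" for m
    using that s2 st t mid by (fastforce simp: linked_def)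
  have M: "fM rs \<mu> \<in> ?U" if "\<mu> \<in> roots_m rs" "snd \<mu> \<le> bsum rs t" for \<mu>
    using that by (cases \<mu>) (auto intro!: fM_units_below simp: \<psi> below_m_iff)
  have L: "fL rs \<phi> \<in> ?U" if "\<phi> \<in> Phi rs" "snd \<phi> \<le> bsum rs t" for \<phi>
    using that subsetD[OF Phi_subset_roots_m that(1)]
    by (cases \<phi>) (auto intro!: fL_units_below simp: \<psi> below_m_iff)
  have base_m: "\<mu> \<in> roots_m rs" if "\<mu> \<in> base rs" for \<mu>
    using that base_subset_roots_m by blast
  have in_row: "base_in_row rs a = (a, b)" if "(a, b) \<in> base rs" for a b
    unfolding base_in_row_def
    by (rule the_equality) (simp_all add: that, metis base_row_col_inj[OF that] prod.collapse)
  have in_col: "base_in_col rs b = (a, b)" if "(a, b) \<in> base rs" for a b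
    unfolding base_in_col_def
    by (rule the_equality) (simp_all add: that, metis base_row_col_inj[OF that] prod.collapse)
  \<comment> \<open>The corner roots before block \<open>s\<close> and after block \<open>t\<close>, present since \<open>2 \<le> s\<close> and \<open>t < length rs\<close>.\<close>
  have \<gamma>1: "(bsum rs (s - 1), ?f) \<in> base rs" using s2 st t by (intro corner_in_base) auto
  have \<gamma>3: "(bsum rs t, bsum rs t + 1) \<in> base rs" using st t by (intro corner_in_base) auto
  have \<gamma>1U: "fM rs (bsum rs (s - 1), ?f) \<in> ?U"
  proof (rule M[OF base_m[OF \<gamma>1]])
    have "?f \<le> bsum rs s" using sb ks by simp
    also have "\<dots> \<le> bsum rs t" using st by (intro bsum_mono) simp
    finally show "snd (bsum rs (s - 1), ?f) \<le> bsum rs t" by simp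
  qed
  have \<gamma>3U: "fM rs (bsum rs t, bsum rs t + 1) \<in> ?U"
    using base_m[OF \<gamma>3] tb kt by (intro fM_units_below) (simp add: \<psi> below_m_iff)
  have D: "D_fun rs s t \<in> ?U \<and> snd (gamma5 rs s t) \<le> bsum rs t"
  proof (rule linorder_cases[of "bsize rs s" "bsize rs t"])
    assume eq: "bsize rs s = bsize rs t"
    have "(?f, bsum rs t) \<in> roots_m rs"
      using in_block_first[OF blocks(1)] in_block_last[OF blocks(2)] st by (auto simp: roots_m_iff)
    then have "fM rs (?f, bsum rs t) \<in> ?U" by (rule M) simp
    then show ?thesis
      using eq \<gamma>1U \<gamma>3U by (simp add: D_fun_def gamma5_def Let_def units_below_mult)
  next
    assume lt: "bsize rs s < bsize rs t"
    let ?c = "col_right rs t (bsize rs s)"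
    have "(?f, ?c) \<in> base rs"
      using base_linked[OF link[of "bsize rs s"]] ks lt sb by (simp add: row_up_def)
    moreover have "(?c, bsum rs t) \<in> roots_r rs"
    proof -
      have "?c < bsum rs t" using lt tb by (simp add: col_right_def)
      moreover have "in_block rs t ?c"
        using ks lt blocks(2) by (auto simp: in_block_col_right)
      ultimately show ?thesis using in_block_last[OF blocks(2)] by (auto simp: roots_r_iff)
    qed
    ultimately have \<xi>: "(?c, bsum rs t + 1) \<in> Phi rs" and g5: "gamma5 rs s t = (?f, ?c)"
      using \<gamma>3 lt in_row by (auto simp: Phi_iff gamma5_def)
    have "(?c, bsum rs t + 1) \<in> below_m rs \<psi>"
      using subsetD[OF Phi_subset_roots_m \<xi>] ks by (simp add: \<psi> below_m_iff col_right_def)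
    then have "fL rs (?c, bsum rs t + 1) \<in> ?U" by (rule fL_units_below[OF \<xi>])
    moreover have "?c \<le> bsum rs t" using lt tb by (simp add: col_right_def)
    ultimately show ?thesis
      using lt \<gamma>1U g5 by (simp add: D_fun_def Let_def phi_of_def units_below_mult)
  next
    assume gt: "bsize rs t < bsize rs s"
    let ?r = "row_up rs s (bsize rs t)"
    have "(?r, bsum rs t) \<in> base rs"
      using base_linked[OF link[of "bsize rs t"]] kt gt tb by (simp add: col_right_def)
    moreover have "(?f, ?r) \<in> roots_r rs"
    proof -
      have "?f < ?r" using gt sb by (simp add: row_up_def)
      moreover have "in_block rs s ?r"
        using kt gt blocks(1) by (auto simp: in_block_row_up)
      ultimately show ?thesis using in_block_first[OF blocks(1)] by (auto simp: roots_r_iff)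
    qed
    ultimately have \<xi>: "(?f, bsum rs t) \<in> Phi rs" and g5: "gamma5 rs s t = (?r, bsum rs t)"
      using \<gamma>1 gt in_col by (auto simp: Phi_iff gamma5_def)
    have "fL rs (?f, bsum rs t) \<in> ?U" by (rule L[OF \<xi>]) simp
    then show ?thesis
      using gt \<gamma>3U g5 by (simp add: D_fun_def Let_def phi_of_def units_below_mult)
  qed
  let ?x = "sorted_list_of_set (Phi_cols rs ?f) ! (k - 1)"
  have \<xi>1: "fL rs (?f, ?x) \<in> ?U"
  proof -
    obtain C where C: "C \<subseteq> Phi_cols rs ?f" "C \<subseteq> {..bsum rs t}" "card C = k"
      using Phi_cols_first_lower[OF s2 st _ ks kt] t by (metis less_imp_le)
    note x = nth_sorted_list_of_set_le[OF finite_Phi_cols C k1]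
    then show ?thesis by (intro L) (auto simp: Phi_cols_def)
  qed
  have Max: "(\<Prod>\<mu>\<in>MaxS rs \<gamma>. fM rs \<mu>) \<in> ?U" if "snd \<gamma> \<le> bsum rs t" for \<gamma>
    using that by (intro units_below_prod M) (auto simp: MaxS_def root_succ_def intro: base_m)
  let ?\<gamma>4 = "base_in_col rs (bsum rs (t - 1) + k + 1)"
  have "(row_up rs s (k + 1), bsum rs (t - 1) + k + 1) \<in> base rs"
    using base_linked[OF link[of "k + 1"]] ks kt by (simp add: col_right_def)
  then have \<gamma>4: "snd ?\<gamma>4 \<le> bsum rs t" using in_col kt tb by simp
  then have Max2: "(\<Prod>\<mu>'\<in>(\<Union>\<mu>\<in>MaxS rs ?\<gamma>4. MaxS rs \<mu>). fM rs \<mu>') \<in> ?U"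
    by (intro units_below_prod M) (auto simp: MaxS_def root_succ_def intro: base_m)
  have the_p: "(THE p. psi2_form rs \<psi> p) = (t, k)"
    using p by (rule the_equality) (auto dest: psi2_form_unique[OF p])
  show ?thesis
  proof (cases "t = s + 1 \<and> (bsize rs s = 2 \<or> bsize rs t = 2)")
    case True
    have "fL rs (?f, ?x) / D_fun rs s t \<in> ?U" using \<xi>1 D by (simp add: units_below_divide)
    moreover have "B_fun rs \<psi> = fL rs \<psi> * (fL rs (?f, ?x) / D_fun rs s t)"
      unfolding B_fun_def Let_def the_p fst_conv snd_conv s_def[symmetric] if_P[OF True] by simp
    ultimately show ?thesis by blast
  next
    case False
    let ?g = "fL rs (?f, ?x) * (\<Prod>\<mu>\<in>MaxS rs (gamma5 rs s t). fM rs \<mu>)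
      / (D_fun rs s t * (\<Prod>\<mu>\<in>MaxS rs ?\<gamma>4. fM rs \<mu>)
         * (\<Prod>\<mu>'\<in>(\<Union>\<mu>\<in>MaxS rs ?\<gamma>4. MaxS rs \<mu>). fM rs \<mu>')) :: 'a ratfun"
    have "?g \<in> ?U"
      using D by (intro units_below_divide units_below_mult \<xi>1 Max Max2 \<gamma>4) auto
    moreover have "B_fun rs \<psi> = fL rs \<psi> * ?g"
      unfolding B_fun_def Let_def the_p fst_conv snd_conv s_def[symmetric] if_not_P[OF False]
      by (simp add: mult.assoc mult.left_commute)
    ultimately show ?thesis by blast
  qed
qed

text \<open>
  A root of \<open>Psi2\<close> is the leftmost possible root of its row, whereas a root of \<open>Psi1\<close> has a root of the base or of
  \<open>Phi\<close> to its left.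
\<close>
lemma Psi1_Psi2_disjoint: "Psi1 rs \<inter> Psi2 rs = {}"
proof (rule ccontr)
  assume "Psi1 rs \<inter> Psi2 rs \<noteq> {}"
  then obtain \<psi> where 1: "\<psi> \<in> Psi1 rs" and 2: "\<psi> \<in> Psi2 rs" by blast
  obtain t k where p: "psi2_form rs \<psi> (t, k)" using 2 by (auto simp: Psi2_def)
  then have \<psi>: "\<psi> = (bsum rs (t - 1) + k, bsum rs t + 1)"
    and t: "t \<in> {1..length rs}" "1 \<le> k" "k < bsize rs t" by (auto simp: psi2_form_def)
  obtain a where a: "a < bsum rs t + 1" "(bsum rs (t - 1) + k, a) \<in> base rs \<union> Phi rs"
    using 1 unfolding Psi1_def is_rectangle_def \<psi> by auto
  then have "(bsum rs (t - 1) + k, a) \<in> roots_m rs"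
    using base_subset_roots_m[of rs] Phi_subset_roots_m[of rs] by blast
  then obtain u v where uv: "u < v" "in_block rs u (bsum rs (t - 1) + k)" "in_block rs v a"
    by (auto simp: roots_m_iff)
  have "in_block rs t (bsum rs (t - 1) + k)" using t bsum_rec[OF t(1)] by (auto simp: in_block_def)
  then have "t < v" using in_block_inj[OF _ uv(2)] uv(1) by blast
  from in_block_less[OF in_block_last[OF t(1)] uv(3) this] show False using a(1) by simp
qed

end

section \<open>Algebraic independence of the two series\<close>

theorem proposition3p7:
  fixes rs :: "nat list"
    and w :: "root \<Rightarrow> root \<times> root \<times> root"
    and A B :: "root \<Rightarrow> 'a::{alg_closed_field, field_char_0} ratfun"
  assumes "rs \<noteq> []" and "\<forall>r\<in>set rs. r > 0"
    and choice: "\<forall>\<psi>\<in>Psi1 rs. is_rectangle rs \<psi> (w \<psi>)"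
  defines "A \<equiv> \<lambda>\<psi>. A_fun rs (w \<psi>) \<psi>"
    and "B \<equiv> B_fun rs"
  shows "A ` Psi1 rs \<union> B ` Psi2 rs \<subseteq> ratfun_m rs \<and>
    alg_independent (Psi1 rs <+> Psi2 rs) (case_sum A B)"
proof -
  interpret positive_blocks rs using assms(2) by unfold_locales
  have sub: "Psi1 rs \<subseteq> Phi rs" "Psi2 rs \<subseteq> Phi rs" by (auto simp: Psi1_def Psi2_def)
  have A: "affine_in col_rank \<psi> (A \<psi>) \<and> A \<psi> \<in> ratfun_m rs" if \<psi>: "\<psi> \<in> Psi1 rs" for \<psi>
  proof -
    have Phi: "\<psi> \<in> Phi rs" using \<psi> sub by blast
    obtain g where g: "g \<in> units_below rs \<psi>" "A \<psi> = fL rs \<psi> * g"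
      using A_fun_factor[OF Phi bspec[OF choice \<psi>]] unfolding A_def by blast
    show ?thesis using fL_times_unit[OF Phi g(1)] by (simp add: g(2))
  qed
  have B: "affine_in col_rank \<psi> (B \<psi>) \<and> B \<psi> \<in> ratfun_m rs" if \<psi>: "\<psi> \<in> Psi2 rs" for \<psi>
  proof -
    have Phi: "\<psi> \<in> Phi rs" using \<psi> sub by blast
    obtain g where g: "g \<in> units_below rs \<psi>" "B \<psi> = fL rs \<psi> * g"
      using B_fun_factor[OF \<psi>] unfolding B_def by blast
    show ?thesis using fL_times_unit[OF Phi g(1)] by (simp add: g(2))
  qed
  have "alg_independent (Psi1 rs <+> Psi2 rs) (case_sum A B)"
  proof (rule triangular_alg_independent[where v = "case_sum id id" and \<rho> = col_rank])
    show "finite (Psi1 rs <+> Psi2 rs)"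
      using finite_subset[OF sub(1) finite_Phi] finite_subset[OF sub(2) finite_Phi] by simp
    show "affine_in col_rank (case_sum id id x) (case_sum A B x)" if "x \<in> Psi1 rs <+> Psi2 rs" for x
      using that A B by auto
    show "inj_on (\<lambda>x. col_rank (case_sum id id x)) (Psi1 rs <+> Psi2 rs)"
      using Psi1_Psi2_disjoint by (auto simp: inj_on_def inj_eq[OF inj_col_rank])
  qed
  then show ?thesis using A B by blast
qed

end
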